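(* Let $m,n\ge2$ be two integers, $d=\gcd(m,n)$ and $d_2=\gcd(2,n)$. Then $$[\mathbb{D}_{2n}^d]\circledcirc[\mathbb{D}_m\oplus\mathbb{Z}_2^c]=\begin{cases}\{[\mathbb{1}],[\mathbb{Z}_2],[\mathbb{D}_{d_2}],[\mathbb{Z}_2^-],[\mathbb{Z}_{2d}^-],[\mathbb{D}_2^z],[\mathbb{D}_{2d}^d]\}&\text{if } m/d\text{ is even},\\ \{[\mathbb{1}],[\mathbb{Z}_2],[\mathbb{D}_2],[\mathbb{Z}_2^-],[\mathbb{D}_2^z],[\mathbb{Z}_d],[\mathbb{D}_d],[\mathbb{D}_d^z]\}&\text{if } m/d\text{ is odd and } m\text{ is even},\\ \{[\mathbb{1}],[\mathbb{Z}_2],[\mathbb{Z}_2^-],[\mathbb{Z}_d],[\mathbb{D}_d],[\mathbb{D}_d^z]\}&\text{otherwise}.\end{cases}$$ (The superscript $d$ in $\mathbb{D}_{2n}^d$ and $\mathbb{D}_{2d}^d$ is part of the name of the group and is unrelated to the integer $d$.)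
   Context: $[K]$ is the conjugacy class of a subgroup $K$ in $\mathrm{O}(3)$, and the clips operation is $[H_1]\circledcirc[H_2]=\{[H_1\cap gH_2g^{-1}]:g\in\mathrm{O}(3)\}$. $(e_1,e_2,e_3)$ is the canonical basis of $\mathbb{R}^3$, $\mathbf{r}(n,\theta)$ is the rotation by angle $\theta$ about the axis directed by $n\neq0$. $\mathbb{1}=\{\mathrm{Id}\}$; $\mathbb{Z}_2^c=\{\pm\mathrm{Id}\}$; $H\oplus\mathbb{Z}_2^c=H\cup(-H)$ for $H\subset\mathrm{SO}(3)$; $\mathbb{Z}_k=\{\mathbf{r}(e_3,2j\pi/k):0\le j\le k-1\}$; $\mathbb{D}_k=\langle\mathbf{r}(e_3,2\pi/k),\mathbf{r}(e_1,\pi)\rangle$ for $k\ge2$ and $\mathbb{D}_1=\langle\mathbf{r}(e_1,\pi)\rangle$; $\mathbb{Z}_{2k}^-=\mathbb{Z}_k\cup(-\mathbf{r}(e_3,\pi/k))\mathbb{Z}_k$ for $k\ge1$; $\mathbb{D}_k^z=\mathbb{Z}_k\cup(-\mathbf{r}(e_1,\pi))\mathbb{Z}_k$ for $k\ge2$; $\mathbb{D}_{2k}^d=\mathbb{D}_k\cup(-\mathbf{r}(e_3,\pi/k))\mathbb{D}_k$ for $k\ge1$. Conventions: $[\mathbb{Z}_1]=[\mathbb{1}]$, $[\mathbb{D}_1]=[\mathbb{Z}_2]$, $[\mathbb{D}_1^z]=[\mathbb{Z}_2^-]$, $[\mathbb{D}_2^z]=[\mathbb{D}_2^d]$. *)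

theory Defs
  imports
    "HOL-Analysis.Analysis"
    "HOL-Algebra.Group_Action"
    "HOL-Algebra.Generated_Groups"
begin

unbundle no cross3_syntax

section \<open>The orthogonal group and its conjugacy classes of subgroups\<close>

definition O3 :: "(real^3^3) monoid" where
  "O3 = \<lparr>carrier = {A. orthogonal_matrix A}, monoid.mult = (**), one = mat 1\<rparr>"

definition conj_subgroup :: "real^3^3 \<Rightarrow> (real^3^3) set \<Rightarrow> (real^3^3) set" where
  "conj_subgroup g H = g <#\<^bsub>O3\<^esub> H #>\<^bsub>O3\<^esub> inv\<^bsub>O3\<^esub> g"

definition conj_class :: "(real^3^3) set \<Rightarrow> (real^3^3) set set" where
  "conj_class K = orbit O3 conj_subgroup K"

text \<open>The clips operation acts on conjugacy classes. Letting the representatives range over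
  both classes makes it independent of choices by construction; lemma \<open>clips_conj_class\<close>
  below recovers the usual formula in terms of fixed representatives.\<close>

definition clips ::
  "(real^3^3) set set \<Rightarrow> (real^3^3) set set \<Rightarrow> (real^3^3) set set set"  (infixl \<open>\<circledcirc>\<close> 70) where
  "C\<^sub>1 \<circledcirc> C\<^sub>2 =
     {conj_class (H\<^sub>1 \<inter> conj_subgroup g H\<^sub>2) | H\<^sub>1 H\<^sub>2 g. H\<^sub>1 \<in> C\<^sub>1 \<and> H\<^sub>2 \<in> C\<^sub>2 \<and> g \<in> carrier O3}"

section \<open>Rotations and the subgroups of the statement\<close>

abbreviation e1 :: "real^3" where "e1 \<equiv> axis 1 1"
abbreviation e3 :: "real^3" where "e3 \<equiv> axis 3 1"

text \<open>Rodrigues' formula for the rotation by \<open>\<theta>\<close> about the axis directed by \<open>n \<noteq> 0\<close>;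
  \<open>sgn n\<close> is the unit vector \<open>n / norm n\<close>.\<close>

definition rot :: "real^3 \<Rightarrow> real \<Rightarrow> real^3^3" where
  "rot n \<theta> = matrix (\<lambda>x. cos \<theta> *\<^sub>R x + sin \<theta> *\<^sub>R cross3 (sgn n) x
                          + ((1 - cos \<theta>) * (sgn n \<bullet> x)) *\<^sub>R sgn n)"

definition trivial_gp :: "(real^3^3) set" where
  "trivial_gp = {mat 1}"

definition plus_Z2c :: "(real^3^3) set \<Rightarrow> (real^3^3) set" where
  "plus_Z2c H = H \<union> uminus ` H"

text \<open>All families below are meant for \<open>k \<ge> 1\<close>. The instances with \<open>k = 1\<close> of the general
  formulas agree with the usual conventions for small indices; see the lemmas at the end.\<close>

definition Z_gp :: "nat \<Rightarrow> (real^3^3) set" where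
  "Z_gp k = {rot e3 (2 * real j * pi / real k) | j. j \<le> k - 1}"

definition D_gp :: "nat \<Rightarrow> (real^3^3) set" where
  "D_gp k = generate O3 {rot e3 (2 * pi / real k), rot e1 pi}"

text \<open>\<open>Z2_minus k\<close> and \<open>D2_d k\<close> are the groups usually written with the subscript \<open>2k\<close>:
  the digit 2 in the name is part of that subscript, so \<open>Z2_minus 1\<close> is
  \<open>\<int>\<^sub>2\<^sup>-\<close>.\<close>

definition Z2_minus :: "nat \<Rightarrow> (real^3^3) set" where
  "Z2_minus k = Z_gp k \<union> ((- rot e3 (pi / real k)) <#\<^bsub>O3\<^esub> Z_gp k)"

definition D_z :: "nat \<Rightarrow> (real^3^3) set" where
  "D_z k = Z_gp k \<union> ((- rot e1 pi) <#\<^bsub>O3\<^esub> Z_gp k)"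

definition D2_d :: "nat \<Rightarrow> (real^3^3) set" where
  "D2_d k = D_gp k \<union> ((- rot e3 (pi / real k)) <#\<^bsub>O3\<^esub> D_gp k)"

section \<open>Well-definedness\<close>

lemma group_O3: "group O3"
proof (rule groupI)
  fix x assume "x \<in> carrier O3"
  then show "\<exists>y\<in>carrier O3. y \<otimes>\<^bsub>O3\<^esub> x = \<one>\<^bsub>O3\<^esub>"
    by (intro bexI[of _ "transpose x"]) (auto simp: O3_def orthogonal_matrix_def)
qed (auto simp: O3_def orthogonal_matrix_mul orthogonal_matrix_id matrix_mul_assoc)

interpretation O3: group O3 by (rule group_O3)

lemma conj_subgroup_eq:
  "conj_subgroup g H = (\<lambda>h. g \<otimes>\<^bsub>O3\<^esub> h \<otimes>\<^bsub>O3\<^esub> inv\<^bsub>O3\<^esub> g) ` H"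
  by (auto simp: conj_subgroup_def l_coset_def r_coset_def)

lemma conj_subgroup_mult:
  assumes "g \<in> carrier O3" "h \<in> carrier O3" "H \<subseteq> carrier O3"
  shows "conj_subgroup g (conj_subgroup h H) = conj_subgroup (g \<otimes>\<^bsub>O3\<^esub> h) H"
  unfolding conj_subgroup_eq image_image
  using assms by (intro image_cong) (auto simp: O3.inv_mult_group O3.m_assoc subset_iff)

lemma conj_subgroup_one: "H \<subseteq> carrier O3 \<Longrightarrow> conj_subgroup \<one>\<^bsub>O3\<^esub> H = H"
  unfolding conj_subgroup_eq by (force simp: image_iff subset_iff)

lemma conj_subgroup_subset:
  "g \<in> carrier O3 \<Longrightarrow> H \<subseteq> carrier O3 \<Longrightarrow> conj_subgroup g H \<subseteq> carrier O3"
  unfolding conj_subgroup_eq by auto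

lemma conj_subgroup_Int:
  assumes "g \<in> carrier O3" "H \<subseteq> carrier O3" "K \<subseteq> carrier O3"
  shows "conj_subgroup g (H \<inter> K) = conj_subgroup g H \<inter> conj_subgroup g K"
  unfolding conj_subgroup_eq
  by (rule inj_on_image_Int[of _ "carrier O3"]) (use assms in \<open>auto intro!: inj_onI\<close>)

lemma conj_class_conj_subgroup:
  assumes g: "g \<in> carrier O3" and H: "H \<subseteq> carrier O3"
  shows "conj_class (conj_subgroup g H) = conj_class H"
proof -
  have "conj_subgroup x H \<in> conj_class (conj_subgroup g H)" if x: "x \<in> carrier O3" for x
  proof -
    have "conj_subgroup x H = conj_subgroup (x \<otimes>\<^bsub>O3\<^esub> inv\<^bsub>O3\<^esub> g) (conj_subgroup g H)"
      using g H x by (simp add: conj_subgroup_mult O3.m_assoc)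
    then show ?thesis
      using g x unfolding conj_class_def orbit_def by blast
  qed
  moreover have "conj_subgroup x (conj_subgroup g H) \<in> conj_class H" if x: "x \<in> carrier O3" for x
    using g H x unfolding conj_class_def orbit_def by (auto simp: conj_subgroup_mult)
  ultimately show ?thesis
    unfolding conj_class_def orbit_def by blast
qed

lemma clips_conj_class:
  assumes H1: "H\<^sub>1 \<subseteq> carrier O3" and H2: "H\<^sub>2 \<subseteq> carrier O3"
  shows "conj_class H\<^sub>1 \<circledcirc> conj_class H\<^sub>2 =
           {conj_class (H\<^sub>1 \<inter> conj_subgroup g H\<^sub>2) | g. g \<in> carrier O3}" (is "?L = ?R")
proof
  show "?L \<subseteq> ?R"
  proof
    fix C assume "C \<in> ?L"
    then obtain a b g where abg: "a \<in> carrier O3" "b \<in> carrier O3" "g \<in> carrier O3"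
      and C: "C = conj_class (conj_subgroup a H\<^sub>1 \<inter> conj_subgroup g (conj_subgroup b H\<^sub>2))"
      unfolding clips_def conj_class_def orbit_def by blast
    define c where "c = inv\<^bsub>O3\<^esub> a \<otimes>\<^bsub>O3\<^esub> (g \<otimes>\<^bsub>O3\<^esub> b)"
    have c: "c \<in> carrier O3" "a \<otimes>\<^bsub>O3\<^esub> c = g \<otimes>\<^bsub>O3\<^esub> b"
      using abg by (auto simp: c_def simp flip: O3.m_assoc)
    have "conj_subgroup g (conj_subgroup b H\<^sub>2) = conj_subgroup a (conj_subgroup c H\<^sub>2)"
      using abg c H2 by (simp add: conj_subgroup_mult)
    then have "C = conj_class (conj_subgroup a (H\<^sub>1 \<inter> conj_subgroup c H\<^sub>2))"
      using C abg c H1 H2 by (simp add: conj_subgroup_Int conj_subgroup_subset)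
    also have "\<dots> = conj_class (H\<^sub>1 \<inter> conj_subgroup c H\<^sub>2)"
      using abg c H1 by (intro conj_class_conj_subgroup) auto
    finally show "C \<in> ?R" using c by blast
  qed
  have "H \<in> conj_class H" if "H \<subseteq> carrier O3" for H
    unfolding conj_class_def orbit_def using conj_subgroup_one[OF that] O3.one_closed by blast
  then show "?R \<subseteq> ?L"
    using H1 H2 unfolding clips_def by blast
qed

section \<open>Conventions for small indices\<close>

lemma rot_e3:
  "rot e3 \<theta> = vector [vector [cos \<theta>, - sin \<theta>, 0], vector [sin \<theta>, cos \<theta>, 0], vector [0, 0, 1]]"
  by (auto simp: rot_def matrix_def vec_eq_iff forall_3 cross3_def axis_def inner_vec_def sum_3
      sgn_div_norm norm_vec_def L2_set_def vector_3)

lemma rot_e1: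
  "rot e1 \<theta> = vector [vector [1, 0, 0], vector [0, cos \<theta>, - sin \<theta>], vector [0, sin \<theta>, cos \<theta>]]"
  by (auto simp: rot_def matrix_def vec_eq_iff forall_3 cross3_def axis_def inner_vec_def sum_3
      sgn_div_norm norm_vec_def L2_set_def vector_3)

lemma rot_e3_0: "rot e3 0 = mat 1" "rot e3 (2 * pi) = mat 1"
  by (auto simp: rot_e3 mat_def vec_eq_iff forall_3 vector_3)

lemma Z_gp_1: "Z_gp 1 = trivial_gp"
  by (auto simp: Z_gp_def trivial_gp_def rot_e3_0)

lemma Z_gp_2: "Z_gp 2 = {mat 1, rot e3 pi}"
proof -
  have "{j::nat. j \<le> 2 - 1} = {0, 1}" by auto
  then show ?thesis
    unfolding Z_gp_def setcompr_eq_image by (simp add: rot_e3_0)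
qed

lemma rot_e1_pi_sq: "rot e1 pi ** rot e1 pi = mat 1"
  by (auto simp: rot_e1 mat_def matrix_matrix_mult_def vec_eq_iff forall_3 sum_3 vector_3)

lemma rot_e1_pi_in_O3: "rot e1 pi \<in> carrier O3"
  by (auto simp: O3_def orthogonal_matrix rot_e1 mat_def matrix_matrix_mult_def transpose_def
      vec_eq_iff forall_3 sum_3 vector_3)

lemma D_gp_1: "D_gp 1 = {mat 1, rot e1 pi}"
proof
  have sub: "subgroup {mat 1, rot e1 pi} O3"
  proof (rule O3.subgroupI)
    fix a assume "a \<in> {mat 1, rot e1 pi}"
    moreover have "inv\<^bsub>O3\<^esub> rot e1 pi = rot e1 pi"
      using rot_e1_pi_in_O3 rot_e1_pi_sq by (intro O3.inv_equality) (auto simp: O3_def)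
    moreover have "inv\<^bsub>O3\<^esub> mat 1 = mat 1"
      using O3.inv_one by (simp add: O3_def)
    ultimately show "inv\<^bsub>O3\<^esub> a \<in> {mat 1, rot e1 pi}" by auto
  next
    show "{mat 1, rot e1 pi} \<subseteq> carrier O3"
      using rot_e1_pi_in_O3 O3.one_closed by (auto simp: O3_def)
  qed (auto simp: O3_def rot_e1_pi_sq)
  show "D_gp 1 \<subseteq> {mat 1, rot e1 pi}"
    unfolding D_gp_def by (rule O3.generate_subgroup_incl[OF _ sub]) (auto simp: rot_e3_0)
  show "{mat 1, rot e1 pi} \<subseteq> D_gp 1"
    unfolding D_gp_def using generate.one[of O3] by (auto simp: O3_def intro: generate.incl)
qed

lemma conj_class_swap_e1_e3:
  assumes "H \<subseteq> carrier O3"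
    and "K = (\<lambda>A. (\<chi> i j. A $ Transposition.transpose 1 3 i $ Transposition.transpose 1 3 j)) ` H"
  shows "conj_class K = conj_class H"
proof -
  define P :: "real^3^3" where "P = vector [vector [0, 0, 1], vector [0, 1, 0], vector [1, 0, 0]]"
  have PP: "P ** P = mat 1"
    by (auto simp: P_def mat_def matrix_matrix_mult_def vec_eq_iff forall_3 sum_3 vector_3)
  have P: "P \<in> carrier O3"
    by (auto simp: P_def O3_def orthogonal_matrix mat_def matrix_matrix_mult_def
        Finite_Cartesian_Product.transpose_def vec_eq_iff forall_3 sum_3 vector_3)
  have "inv\<^bsub>O3\<^esub> P = P"
    using P PP by (intro O3.inv_equality) (auto simp: O3_def)
  moreover have "P ** A ** P
      = (\<chi> i j. A $ Transposition.transpose 1 3 i $ Transposition.transpose 1 3 j)" for A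
    by (auto simp: P_def matrix_matrix_mult_def vec_eq_iff forall_3 sum_3 vector_3
        Transposition.transpose_def)
  ultimately have "K = conj_subgroup P H"
    unfolding conj_subgroup_eq assms(2) by (simp add: O3_def)
  then show ?thesis
    using conj_class_conj_subgroup[OF P assms(1)] by simp
qed

lemmas swap_simps = rot_e1 rot_e3 O3_def mat_def matrix_matrix_mult_def vec_eq_iff forall_3 sum_3
  vector_3 Transposition.transpose_def orthogonal_matrix Finite_Cartesian_Product.transpose_def

lemma conj_class_D_gp_1: "conj_class (D_gp 1) = conj_class (Z_gp 2)"
  unfolding D_gp_1 Z_gp_2 by (rule conj_class_swap_e1_e3) (auto simp: swap_simps)

lemma conj_class_D_z_1: "conj_class (D_z 1) = conj_class (Z2_minus 1)"
  unfolding D_z_def Z2_minus_def Z_gp_1 trivial_gp_def l_coset_def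
  by (rule conj_class_swap_e1_e3) (auto simp: swap_simps)

lemma conj_class_D_z_2: "conj_class (D_z 2) = conj_class (D2_d 1)"
  unfolding D_z_def D2_d_def Z_gp_2 D_gp_1 l_coset_def
  by (rule conj_class_swap_e1_e3) (auto simp: swap_simps)

end

theory Submission
  imports Defs
begin

text \<open>The group \<open>D2_d n\<close> contains, for every integer \<open>j\<close>, the rotation by \<open>j\<pi>/n\<close> about \<open>e3\<close> and the
half-turn about the horizontal line at angle \<open>j\<pi>/(2n)\<close>, both multiplied by \<open>(-1)^j\<close>
(\<open>D2_d_eq\<close>). It is thus the dihedral rotation group of order \<open>4n\<close> twisted by a sign character. The
group \<open>D_gp m \<oplus> \<int>\<^sub>2\<^sup>c\<close>, called \<open>prism m 0\<close> below, is stable under negation. Intersecting with a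
conjugate of it therefore amounts to intersecting two dihedral groups of rotations and then
restoring the signs of \<open>D2_d n\<close>. The outcome depends on the position of \<open>g e3\<close>, the main axis of
the conjugate.

Coaxial case: \<open>g e3 = \<plusminus>e3\<close>. The conjugate is \<open>prism m\<close> with its horizontal axes turned by some
angle \<open>\<tau>/2\<close>. The common rotations about \<open>e3\<close> have the indices \<open>j\<close> with \<open>2n\<close> dividing \<open>mj\<close>. With
\<open>d = gcd m n\<close>, these are the multiples of the odd number \<open>n/d\<close> if \<open>m/d\<close> is even, which yields
alternating signs and \<open>Z2_minus d\<close>; they are the multiples of \<open>2n/d\<close> if \<open>m/d\<close> is odd, which yields
only plus signs and \<open>Z_gp d\<close>. If the two groups have no common horizontal axis, nothing else is
shared. Otherwise the common half-turns form one coset of the common rotations. In the odd case all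
of them have the same sign, giving \<open>D_gp d\<close> or \<open>D_z d\<close>; in the even case both signs occur and the
group is \<open>D2_d d\<close>. This is \<open>coaxial_classes\<close>.

Distinct axes: every common element maps \<open>a = g e3\<close> to \<open>\<plusminus>a\<close>. Up to sign it is then the identity or a
half-turn about one of three mutually orthogonal lines: the vertical one and two horizontal ones
fixed by the azimuth of \<open>a\<close>. In suitable coordinates the intersection is a group of diagonal sign
matrices without \<open>-1\<close>. Such a group is trivial, or conjugate to \<open>Z_gp 2\<close> or \<open>Z2_minus 1\<close>, or a Klein
four-group, and Klein four-groups are conjugate to \<open>D_gp 2\<close> or \<open>D_z 2\<close>
(\<open>diag_signs_subgroup_cases\<close>). In the Klein case \<open>a\<close> is horizontal and the half-turn about \<open>a\<close>
is, up to sign, in the conjugate of \<open>prism m 0\<close>, which forces \<open>m\<close> to be even. The half-turn about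
\<open>e3\<close> has sign \<open>(-1)^n\<close>, so \<open>D_gp 2\<close> requires \<open>n\<close> to be even (\<open>klein_intersection\<close>). Explicit conjugations
realize all remaining possibilities, so the list in \<open>tilted_classes\<close> is exact. The theorem is the
union of the two lists.\<close>

section \<open>Rotations and half-turns about the coordinate axes\<close>

abbreviation tr :: "real^3^3 \<Rightarrow> real^3^3" where "tr \<equiv> Finite_Cartesian_Product.transpose"

text \<open>The half-turn about the horizontal line at angle \<open>t/2\<close>. The parameter is twice the angle of the axis
so that products with rotations about \<open>e3\<close> become additions of parameters.\<close>

definition half_turn :: "real \<Rightarrow> real^3^3" where "half_turn t = rot e3 t ** rot e1 pi"

lemma half_turn_matrix: "half_turn t
    = vector [vector [cos t, sin t, 0], vector [sin t, - cos t, 0], vector [0, 0, -1]]"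
  by (auto simp: half_turn_def rot_e3 rot_e1 matrix_matrix_mult_def vec_eq_iff forall_3 sum_3)

lemmas mat3 = rot_e3 half_turn_matrix rot_e1 matrix_matrix_mult_def vec_eq_iff forall_3 sum_3
   mat_def Finite_Cartesian_Product.transpose_def

lemma half_turn_0: "half_turn 0 = rot e1 pi" by (simp add: mat3)

lemma rot_half_turn_mult:
  "rot e3 s ** rot e3 t = rot e3 (s + t)"
  "rot e3 s ** half_turn t = half_turn (s + t)"
  "half_turn s ** rot e3 t = half_turn (s - t)"
  "half_turn s ** half_turn t = rot e3 (s - t)"
  by (auto simp: mat3 cos_add sin_add cos_diff sin_diff algebra_simps)

lemma transpose_rot_half_turn: "tr (rot e3 t) = rot e3 (- t)" "tr (half_turn t) = half_turn t"
  by (auto simp: mat3)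

lemma rot_half_turn_in_O3: "rot e3 t \<in> carrier O3" "half_turn t \<in> carrier O3"
  by (simp_all add: O3_def orthogonal_matrix transpose_rot_half_turn rot_half_turn_mult rot_e3_0)

lemma rot_eq_iff: "rot e3 s = rot e3 t \<longleftrightarrow> (\<exists>k::int. s = t + 2 * pi * k)"
  unfolding sin_cos_eq_iff[symmetric] by (auto simp: mat3)

lemma half_turn_eq_iff: "half_turn s = half_turn t \<longleftrightarrow> (\<exists>k::int. s = t + 2 * pi * k)"
  unfolding sin_cos_eq_iff[symmetric] by (auto simp: mat3)

text \<open>A rotation about \<open>e3\<close> has lower right entry \<open>1\<close> and a half-turn has \<open>-1\<close>, which detects the sign
within each of the two families. Rotations and half-turns restrict to the horizontal plane with determinants
\<open>1\<close> and \<open>-1\<close>, and negation does not change this determinant.\<close>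

lemma signed_rot_half_turn_eq:
  assumes "a \<in> {1,-1::real}" "b \<in> {1,-1}"
  shows "a *\<^sub>R rot e3 s = b *\<^sub>R rot e3 t \<longleftrightarrow> a = b \<and> rot e3 s = rot e3 t"
   "a *\<^sub>R half_turn s = b *\<^sub>R half_turn t \<longleftrightarrow> a = b \<and> half_turn s = half_turn t"
   "a *\<^sub>R rot e3 s \<noteq> b *\<^sub>R half_turn t"
   "a *\<^sub>R half_turn s \<noteq> b *\<^sub>R rot e3 t"
proof -
  show "a *\<^sub>R rot e3 s = b *\<^sub>R rot e3 t \<longleftrightarrow> a = b \<and> rot e3 s = rot e3 t"
   "a *\<^sub>R half_turn s = b *\<^sub>R half_turn t \<longleftrightarrow> a = b \<and> half_turn s = half_turn t"
    using assms by (auto simp: mat3)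
  have *: False if "c * cos u = d * cos v" "c * sin u = d * sin v" "c * cos u = - (d * cos v)"
      "c * sin u = - (d * sin v)"
    "c \<in> {1,-1}" for c d u v :: real
    using that sin_zero_abs_cos_one[of u] by auto
  show "a *\<^sub>R rot e3 s \<noteq> b *\<^sub>R half_turn t" "a *\<^sub>R half_turn s \<noteq> b *\<^sub>R rot e3 t"
    using *[of a s b t] *[of b t a s] assms by (auto simp: mat3)
qed

section \<open>The groups as families indexed by the integers\<close>

definition alt_sign :: "int \<Rightarrow> real" where "alt_sign j = (if even j then 1 else -1)"

lemma alt_sign: "alt_sign j \<in> {1,-1}" "alt_sign i * alt_sign j = alt_sign (i + j)"
    "alt_sign (i - j) = alt_sign (i + j)" "alt_sign (- i) = alt_sign i"
  by (auto simp: alt_sign_def)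

text \<open>The group \<open>D_gp m \<oplus> \<int>\<^sub>2\<^sup>c\<close> turned about \<open>e3\<close> by the angle \<open>\<tau>/2\<close>. All its conjugates with main axis
\<open>e3\<close> have this form (\<open>conj_prism_coaxial\<close>).\<close>

definition prism :: "nat \<Rightarrow> real \<Rightarrow> (real^3^3) set" where
  "prism m \<tau> = {\<epsilon> *\<^sub>R rot e3 (2 * pi * of_int i / m) | \<epsilon> i. \<epsilon> \<in> {1,-1}}
     \<union> {\<epsilon> *\<^sub>R half_turn (2 * pi * of_int i / m + \<tau>) | \<epsilon> i. \<epsilon> \<in> {1,-1}}"

lemma mult_O3: "x \<otimes>\<^bsub>O3\<^esub> y = x ** y"
  by (simp add: O3_def)

lemma inv_O3: "g \<in> carrier O3 \<Longrightarrow> inv\<^bsub>O3\<^esub> g = tr g"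
  by (rule O3.inv_equality) (auto simp: O3_def orthogonal_matrix_def)

lemma conj_subgroup_matrix:
  "g \<in> carrier O3 \<Longrightarrow> conj_subgroup g H = (\<lambda>h. g ** h ** tr g) ` H"
  unfolding conj_subgroup_eq by (simp add: inv_O3) (simp add: O3_def)

text \<open>Indexing by all integers instead of a range of naturals makes closure under products and inverses
immediate; the index matters only modulo \<open>k\<close>.\<close>

lemma Z_gp_eq:
  assumes "k \<ge> 1"
  shows "Z_gp k = range (\<lambda>j::int. rot e3 (2 * pi * j / k))"
proof
  show "Z_gp k \<subseteq> range (\<lambda>j::int. rot e3 (2 * pi * j / k))"
  proof
    fix x assume "x \<in> Z_gp k"
    then obtain j where "x = rot e3 (2 * real j * pi / k)" unfolding Z_gp_def by blast
    then have "x = rot e3 (2 * pi * int j / k)" by (simp add: algebra_simps)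
    then show "x \<in> range (\<lambda>j::int. rot e3 (2 * pi * j / k))" by blast
  qed
next
  show "range (\<lambda>j::int. rot e3 (2 * pi * j / k)) \<subseteq> Z_gp k"
  proof (clarify)
    fix j :: int
    define i where "i = nat (j mod int k)"
    have i: "int i = j mod int k" "i < k" using assms by (auto simp: i_def nat_less_iff)
    have "j = int i + int k * (j div int k)" using i by simp
    then have "real_of_int j = real i + real k * of_int (j div int k)"
      by (metis of_int_add of_int_mult of_int_of_nat_eq)
    then have "2 * pi * j / k = 2 * real i * pi / k + 2 * pi * of_int (j div int k)"
      using assms by (simp add: field_simps)
    then have "rot e3 (2 * pi * j / k) = rot e3 (2 * real i * pi / k)"
      unfolding rot_eq_iff by blast
    then show "rot e3 (2 * pi * j / k) \<in> Z_gp k"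
      using i(2) unfolding Z_gp_def by auto
  qed
qed

lemma D_gp_eq:
  assumes "k \<ge> 1"
  shows "D_gp k = range (\<lambda>j::int. rot e3 (2 * pi * j / k))
      \<union> range (\<lambda>j::int. half_turn (2 * pi * j / k))" (is "_ = ?R \<union> ?F")
proof
  have eq: "rot e3 (2 * pi * i / k) ** rot e3 (2 * pi * j / k) = rot e3 (2 * pi * of_int (i + j) / k)"
       "rot e3 (2 * pi * i / k) ** half_turn (2 * pi * j / k) = half_turn (2 * pi * of_int (i + j) / k)"
       "half_turn (2 * pi * i / k) ** rot e3 (2 * pi * j / k) = half_turn (2 * pi * of_int (i - j) / k)"
       "half_turn (2 * pi * i / k) ** half_turn (2 * pi * j / k)
           = rot e3 (2 * pi * of_int (i - j) / k)" for i j :: int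
    by (simp_all add: rot_half_turn_mult add_divide_distrib diff_divide_distrib distrib_left right_diff_distrib)
  have "subgroup (?R \<union> ?F) O3"
  proof (rule O3.subgroupI)
    show "?R \<union> ?F \<subseteq> carrier O3" using rot_half_turn_in_O3 by auto
    fix a assume a: "a \<in> ?R \<union> ?F"
    have "tr (rot e3 (2 * pi * j / k)) = rot e3 (2 * pi * of_int (- j) / k)" for j :: int
      by (simp add: transpose_rot_half_turn)
    with a have "tr a \<in> ?R \<union> ?F" by (elim UnE rangeE) (simp_all only: transpose_rot_half_turn(2), blast+)
    moreover have "a \<in> carrier O3" using a rot_half_turn_in_O3 by auto
    ultimately show "inv\<^bsub>O3\<^esub> a \<in> ?R \<union> ?F" by (simp add: inv_O3)
    fix b assume b: "b \<in> ?R \<union> ?F"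
    have "a ** b \<in> ?R \<union> ?F"
      using a b by (elim UnE rangeE) (simp_all only: eq, blast+)
    then show "a \<otimes>\<^bsub>O3\<^esub> b \<in> ?R \<union> ?F" by (simp add: O3_def)
  qed auto
  moreover have "{rot e3 (2 * pi / real k), rot e1 pi} \<subseteq> ?R \<union> ?F"
    using rangeI[of "\<lambda>j::int. rot e3 (2 * pi * j / k)" 1] rangeI[of "\<lambda>j::int. half_turn (2 * pi * j / k)" 0]
    by (simp add: half_turn_0)
  ultimately show "D_gp k \<subseteq> ?R \<union> ?F"
    unfolding D_gp_def by (intro O3.generate_subgroup_incl)
  have pow: "rot e3 (2 * real j * pi / k) \<in> D_gp k" for j
  proof (induction j)
    case 0
    then show ?case using generate.one[of O3] by (simp add: D_gp_def rot_e3_0 O3_def)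
  next
    case (Suc j)
    have "rot e3 (2 * pi / k) \<in> D_gp k" by (simp add: D_gp_def generate.incl)
    from generate.eng[OF this[unfolded D_gp_def] Suc[unfolded D_gp_def]]
    have "rot e3 (2 * pi / k) ** rot e3 (2 * real j * pi / k) \<in> D_gp k"
      by (simp add: D_gp_def mult_O3)
    then show ?case by (simp add: rot_half_turn_mult add_divide_distrib[symmetric] algebra_simps)
  qed
  then have R: "?R \<subseteq> D_gp k" unfolding Z_gp_eq[OF assms, symmetric] Z_gp_def by auto
  moreover have "half_turn (2 * pi * j / k) \<in> D_gp k" for j :: int
  proof -
    have "rot e1 pi \<in> D_gp k" by (simp add: D_gp_def generate.incl)
    moreover have "rot e3 (2 * pi * j / k) \<in> D_gp k" using R by blast
    ultimately show ?thesis unfolding D_gp_def half_turn_def by (metis generate.eng mult_O3)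
  qed
  ultimately show "?R \<union> ?F \<subseteq> D_gp k" by blast
qed

lemma neg_mult_matrix: "(- A) ** B = - (A ** (B::real^3^3))" "A ** (- B) = - (A ** (B::real^3^3))"
  by (simp_all add: matrix_matrix_mult_def vec_eq_iff sum_negf)

lemma scaleR_mult_matrix: "(a *\<^sub>R A) ** B = a *\<^sub>R (A ** (B::real^3^3))"
    "A ** (a *\<^sub>R B) = a *\<^sub>R (A ** (B::real^3^3))"
  by (simp_all add: matrix_scalar_ac scalar_matrix_assoc)

lemma l_coset_O3: "g <#\<^bsub>O3\<^esub> H = (\<lambda>h. g ** h) ` H"
  by (auto simp: l_coset_def O3_def)

lemma range_int_even_odd: "range (f :: int \<Rightarrow> 'a) = range (\<lambda>j. f (2 * j)) \<union> range (\<lambda>j. f (2 * j + 1))"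
proof -
  have "f j \<in> range (\<lambda>j. f (2 * j)) \<union> range (\<lambda>j. f (2 * j + 1))" for j
    by (cases "even j") (auto elim!: evenE oddE)
  then show ?thesis by auto
qed

lemma Z2_minus_eq:
  assumes "k \<ge> 1"
  shows "Z2_minus k = range (\<lambda>j::int. alt_sign j *\<^sub>R rot e3 (pi * j / k))"
proof -
  have "(- rot e3 (pi / k)) ** rot e3 (2 * pi * j / k) = - rot e3 (pi * of_int (2 * j + 1) / k)" for j :: int
    by (simp add: neg_mult_matrix rot_half_turn_mult add_divide_distrib distrib_left mult_ac add_ac)
  then show ?thesis
    unfolding Z2_minus_def l_coset_O3 Z_gp_eq[OF assms] image_image
      range_int_even_odd[of "\<lambda>j. alt_sign j *\<^sub>R rot e3 (pi * j / k)"]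
    by (simp add: alt_sign_def mult_ac)
qed

text \<open>The even indices come from \<open>D_gp k\<close> and the odd ones from its coset of \<open>- rot e3 (pi / k)\<close>, so the sign is
that of \<open>(-1)^j\<close>.\<close>

lemma D2_d_eq:
  assumes "k \<ge> 1"
  shows "D2_d k = range (\<lambda>j::int. alt_sign j *\<^sub>R rot e3 (pi * j / k))
      \<union> range (\<lambda>j::int. alt_sign j *\<^sub>R half_turn (pi * j / k))"
proof -
  have "(- rot e3 (pi / k)) ** rot e3 (2 * pi * j / k) = - rot e3 (pi * of_int (2 * j + 1) / k)"
    "(- rot e3 (pi / k)) ** half_turn (2 * pi * j / k)
        = - half_turn (pi * of_int (2 * j + 1) / k)" for j :: int
    by (simp_all add: neg_mult_matrix rot_half_turn_mult add_divide_distrib distrib_left mult_ac add_ac)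
  then show ?thesis
    unfolding D2_d_def l_coset_O3 D_gp_eq[OF assms] image_image image_Un
      range_int_even_odd[of "\<lambda>j. alt_sign j *\<^sub>R rot e3 (pi * j / k)"]
      range_int_even_odd[of "\<lambda>j. alt_sign j *\<^sub>R half_turn (pi * j / k)"]
    by (simp add: alt_sign_def mult_ac Un_ac)
qed

lemma D_z_eq:
  assumes "k \<ge> 1"
  shows "D_z k = range (\<lambda>j::int. rot e3 (2 * pi * j / k)) \<union> range (\<lambda>j::int. - half_turn (2 * pi * j / k))"
proof -
  have "(- rot e1 pi) ** rot e3 (2 * pi * j / k) = - half_turn (2 * pi * of_int (- j) / k)" for j :: int
    by (simp add: neg_mult_matrix rot_half_turn_mult half_turn_0[symmetric])
  moreover have "range (\<lambda>j::int. - half_turn (2 * pi * of_int (- j) / k))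
      = range (\<lambda>j::int. - half_turn (2 * pi * j / k))"
    using image_image[of "\<lambda>j. - half_turn (2 * pi * of_int j / k)" uminus "UNIV::int set"] by simp
  ultimately show ?thesis
    unfolding D_z_def l_coset_O3 Z_gp_eq[OF assms] image_image by simp
qed

lemma plus_Z2c_D_gp:
  assumes "m \<ge> 1"
  shows "plus_Z2c (D_gp m) = prism m 0"
proof -
  have "{a *\<^sub>R f i | a i. a \<in> {1,-1::real}} = range f \<union> range (\<lambda>i. - f i)" for f :: "int \<Rightarrow> real^3^3"
    by force
  from this[of "\<lambda>i. rot e3 (2 * pi * i / m)"] this[of "\<lambda>i. half_turn (2 * pi * i / m)"]
  show ?thesis
    unfolding plus_Z2c_def D_gp_eq[OF assms] prism_def image_Un image_image by (simp add: Un_ac)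
qed

lemma mem_conj_subgroup_iff:
  assumes "g \<in> carrier O3"
  shows "x \<in> conj_subgroup g H \<longleftrightarrow> tr g ** x ** g \<in> H"
proof -
  have gg: "tr g ** g = mat 1" "g ** tr g = mat 1" using assms by (auto simp: O3_def orthogonal_matrix_def)
  have 1: "g ** (tr g ** x ** g) ** tr g = x" for x
  proof -
    have "g ** (tr g ** x ** g) ** tr g = (g ** tr g) ** x ** (g ** tr g)" by (simp only: matrix_mul_assoc)
    then show ?thesis by (simp add: gg)
  qed
  have 2: "tr g ** (g ** x ** tr g) ** g = x" for x
  proof -
    have "tr g ** (g ** x ** tr g) ** g = (tr g ** g) ** x ** (tr g ** g)" by (simp only: matrix_mul_assoc)
    then show ?thesis by (simp add: gg)
  qed
  show ?thesis unfolding conj_subgroup_matrix[OF assms]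
  proof
    assume "x \<in> (\<lambda>h. g ** h ** tr g) ` H"
    then obtain h where "h \<in> H" "x = g ** h ** tr g" by blast
    then show "tr g ** x ** g \<in> H" using 2[of h] by simp
  next
    assume "tr g ** x ** g \<in> H"
    then show "x \<in> (\<lambda>h. g ** h ** tr g) ` H" using 1[of x]
        by (intro image_eqI[of _ _ "tr g ** x ** g"]) simp_all
  qed
qed

text \<open>For a set of diagonal sign matrices containing the identity this means being a subgroup, because such
matrices are their own inverses.\<close>

definition mult_closed :: "(real^3^3) set \<Rightarrow> bool" where
  "mult_closed H \<longleftrightarrow> (\<forall>x\<in>H. \<forall>y\<in>H. x ** y \<in> H)"

lemma mult_closed_Int: "mult_closed H \<Longrightarrow> mult_closed K \<Longrightarrow> mult_closed (H \<inter> K)"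
  by (auto simp: mult_closed_def)

lemma mult_closed_conj:
  assumes "g \<in> carrier O3" "mult_closed H"
  shows "mult_closed (conj_subgroup g H)"
proof -
  have gg: "tr g ** g = mat 1" using assms by (auto simp: O3_def orthogonal_matrix_def)
  have "(g ** x ** tr g) ** (g ** y ** tr g) = g ** (x ** y) ** tr g" for x y
  proof -
    have "(g ** x ** tr g) ** (g ** y ** tr g) = g ** x ** (tr g ** g) ** y ** tr g"
        by (simp only: matrix_mul_assoc)
    then show ?thesis by (simp add: gg matrix_mul_assoc)
  qed
  then show ?thesis using assms(2) unfolding conj_subgroup_matrix[OF assms(1)] mult_closed_def by auto
qed

lemma mult_closed_D2_d:
  assumes "k \<ge> 1" shows "mult_closed (D2_d k)"
proof -
  have eq: "(alt_sign i *\<^sub>R rot e3 (pi * i / k)) ** (alt_sign j *\<^sub>R rot e3 (pi * j / k))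
      = alt_sign (i+j) *\<^sub>R rot e3 (pi * of_int (i + j) / k)"
       "(alt_sign i *\<^sub>R rot e3 (pi * i / k)) ** (alt_sign j *\<^sub>R half_turn (pi * j / k))
           = alt_sign (i+j) *\<^sub>R half_turn (pi * of_int (i + j) / k)"
       "(alt_sign i *\<^sub>R half_turn (pi * i / k)) ** (alt_sign j *\<^sub>R rot e3 (pi * j / k))
           = alt_sign (i-j) *\<^sub>R half_turn (pi * of_int (i - j) / k)"
       "(alt_sign i *\<^sub>R half_turn (pi * i / k)) ** (alt_sign j *\<^sub>R half_turn (pi * j / k))
           = alt_sign (i-j) *\<^sub>R rot e3 (pi * of_int (i - j) / k)" for i j :: int
    by (simp_all add: rot_half_turn_mult alt_sign add.commute[of j i] scaleR_mult_matrix add_divide_distrib diff_divide_distrib distrib_left right_diff_distrib)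
  show ?thesis unfolding mult_closed_def D2_d_eq[OF assms]
  proof (intro ballI)
    fix x y assume "x \<in> range (\<lambda>j::int. alt_sign j *\<^sub>R rot e3 (pi * j / k))
        \<union> range (\<lambda>j::int. alt_sign j *\<^sub>R half_turn (pi * j / k))"
      "y \<in> range (\<lambda>j::int. alt_sign j *\<^sub>R rot e3 (pi * j / k))
          \<union> range (\<lambda>j::int. alt_sign j *\<^sub>R half_turn (pi * j / k))"
    then show "x ** y \<in> range (\<lambda>j::int. alt_sign j *\<^sub>R rot e3 (pi * j / k))
        \<union> range (\<lambda>j::int. alt_sign j *\<^sub>R half_turn (pi * j / k))"
      by (elim UnE rangeE) (simp_all only: eq, blast+)
  qed
qed

lemma prismI:
  assumes "a \<in> {1,-1}"
  shows "a *\<^sub>R rot e3 (2 * pi * of_int i / m) \<in> prism m \<tau>"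
      "a *\<^sub>R half_turn (2 * pi * of_int i / m + \<tau>) \<in> prism m \<tau>"
  using assms unfolding prism_def by blast+

lemma prismE:
  assumes "x \<in> prism m \<tau>"
  obtains a and i :: int where "a \<in> {1,-1}" "x = a *\<^sub>R rot e3 (2 * pi * of_int i / m)"
    | a and i :: int where "a \<in> {1,-1}" "x = a *\<^sub>R half_turn (2 * pi * of_int i / m + \<tau>)"
  using assms unfolding prism_def by blast

lemma mult_closed_prism: "mult_closed (prism k 0)"
proof -
  have eq: "(a *\<^sub>R rot e3 (2 * pi * i / k)) ** (b *\<^sub>R rot e3 (2 * pi * j / k))
      = (a * b) *\<^sub>R rot e3 (2 * pi * of_int (i + j) / k)"
       "(a *\<^sub>R rot e3 (2 * pi * i / k)) ** (b *\<^sub>R half_turn (2 * pi * j / k + 0))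
           = (a * b) *\<^sub>R half_turn (2 * pi * of_int (i + j) / k + 0)"
       "(a *\<^sub>R half_turn (2 * pi * i / k + 0)) ** (b *\<^sub>R rot e3 (2 * pi * j / k))
           = (a * b) *\<^sub>R half_turn (2 * pi * of_int (i - j) / k + 0)"
       "(a *\<^sub>R half_turn (2 * pi * i / k + 0)) ** (b *\<^sub>R half_turn (2 * pi * j / k + 0))
           = (a * b) *\<^sub>R rot e3 (2 * pi * of_int (i - j) / k)" for i j :: int and a b :: real
    by (simp_all add: rot_half_turn_mult scaleR_mult_matrix add_divide_distrib diff_divide_distrib distrib_left right_diff_distrib)
  have ab: "a * b \<in> {1,-1}" if "a \<in> {1,-1}" "b \<in> {1,-1}" for a b :: real using that by auto
  show ?thesis unfolding mult_closed_def
  proof (intro ballI)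
    fix x y assume "x \<in> prism k 0" "y \<in> prism k 0"
    then show "x ** y \<in> prism k 0"
      by (elim prismE) (simp_all only: eq, (intro prismI ab; assumption)+)
  qed
qed

section \<open>Orthogonal matrices preserving the third axis\<close>

text \<open>If the third column is vertical, orthogonality makes the third row vertical as well, so \<open>g\<close> is a plane
orthogonal matrix next to a sign.\<close>

lemma orthogonal_preserving_axis:
  assumes "orthogonal_matrix g" "(g *v e3) $ 1 = 0" "(g *v e3) $ 2 = 0"
  obtains \<epsilon> t where "\<epsilon> \<in> {1,-1::real}" "g = \<epsilon> *\<^sub>R rot e3 t \<or> g = \<epsilon> *\<^sub>R half_turn t"
proof -
  have c: "g $ 1 $ 3 = 0" "g $ 2 $ 3 = 0"
    using assms(2,3) by (auto simp: matrix_vector_mult_def sum_3 axis_def)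
  have o: "tr g ** g = mat 1" "g ** tr g = mat 1" using assms(1) by (auto simp: orthogonal_matrix_def)
  have o1: "(tr g ** g) $ i $ j = (if i = j then 1 else 0)"
      "(g ** tr g) $ i $ j = (if i = j then 1 else 0)" for i j
    unfolding o by (simp_all add: mat_def)
  have g33: "(g $ 3 $ 3)\<^sup>2 = 1"
    using o1(1)[of 3 3] c
        by (simp add: matrix_matrix_mult_def Finite_Cartesian_Product.transpose_def sum_3 power2_eq_square)
  then have g3: "g $ 3 $ 3 = 1 \<or> g $ 3 $ 3 = -1" using power2_eq_1_iff by blast
  then have r: "g $ 3 $ 1 = 0" "g $ 3 $ 2 = 0"
    using o1(1)[of 3 1] o1(1)[of 3 2] c
        by (auto simp: matrix_matrix_mult_def Finite_Cartesian_Product.transpose_def sum_3)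
  have "(g $ 1 $ 1)\<^sup>2 + (g $ 2 $ 1)\<^sup>2 = 1"
    using o1(1)[of 1 1] r
        by (simp add: matrix_matrix_mult_def Finite_Cartesian_Product.transpose_def sum_3 power2_eq_square)
  then obtain t where t: "g $ 1 $ 1 = cos t" "g $ 2 $ 1 = sin t" using sincos_total_2pi by metis
  define b d where "b = g $ 1 $ 2" and "d = g $ 2 $ 2"
  have bd: "cos t * b + sin t * d = 0" "b\<^sup>2 + d\<^sup>2 = 1"
    using o1(1)[of 1 2] o1(1)[of 2 2] r t
    by (simp_all add: matrix_matrix_mult_def Finite_Cartesian_Product.transpose_def sum_3 power2_eq_square b_def d_def)
  \<comment> \<open>The determinant of the horizontal block; it is \<open>1\<close> or \<open>-1\<close> and determines the second column.\<close>
  define \<delta> where "\<delta> = d * cos t - b * sin t"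
  have cs: "(cos t)\<^sup>2 + (sin t)\<^sup>2 = 1" by simp
  have b: "b = - \<delta> * sin t" and d: "d = \<delta> * cos t"
    using bd(1) cs unfolding \<delta>_def by algebra+
  have "\<delta>\<^sup>2 = 1" using bd cs unfolding \<delta>_def by algebra
  then have \<delta>: "\<delta> = 1 \<or> \<delta> = -1" using power2_eq_1_iff by blast
  have bd': "g $ 1 $ 2 = - \<delta> * sin t" "g $ 2 $ 2 = \<delta> * cos t" using b d by (auto simp: b_def d_def)
  have "g = 1 *\<^sub>R rot e3 t \<or> g = 1 *\<^sub>R half_turn t \<or> g = (-1) *\<^sub>R rot e3 (t + pi) \<or> g
      = (-1) *\<^sub>R half_turn (t + pi)"
    using \<delta> g3 c r t bd' by (elim disjE) (simp_all add: mat3)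
  then show ?thesis using that[of 1] that[of "-1"] by blast
qed

lemma scaleR_in_O3:
  assumes "A \<in> carrier O3" "e \<in> {1,-1::real}"
  shows "e *\<^sub>R A \<in> carrier O3"
proof -
  have tg: "tr (e *\<^sub>R A) = e *\<^sub>R tr A" by (simp add: mat3)
  have "e * e = 1" using assms(2) by auto
  then show ?thesis
    using assms(1) by (simp add: O3_def orthogonal_matrix_def tg scaleR_mult_matrix)
qed

lemma D2_d_subset_O3: "n \<ge> 1 \<Longrightarrow> D2_d n \<subseteq> carrier O3"
  using scaleR_in_O3[OF rot_half_turn_in_O3(1) alt_sign(1)] scaleR_in_O3[OF rot_half_turn_in_O3(2) alt_sign(1)]
  by (simp only: D2_d_eq) blast

lemma prism_subset_O3: "prism m \<tau> \<subseteq> carrier O3"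
proof
  fix x assume "x \<in> prism m \<tau>"
  then show "x \<in> carrier O3"
    using scaleR_in_O3[OF rot_half_turn_in_O3(1)] scaleR_in_O3[OF rot_half_turn_in_O3(2)]
        by (elim prismE) simp_all
qed

text \<open>Conjugation by a half-turn reverses rotations and reflects horizontal axes. This differs from the
effect of a rotation only by reversing the index \<open>i\<close>.\<close>

lemma conj_prism_coaxial:
  assumes e: "e \<in> {1,-1::real}" and g: "g = e *\<^sub>R rot e3 t \<or> g = e *\<^sub>R half_turn t"
  shows "conj_subgroup g (prism m 0) = prism m (2 * t)"
proof -
  have tg: "tr (a *\<^sub>R A) = a *\<^sub>R tr A" for a and A :: "real^3^3" by (simp add: mat3)
  have ee: "e * e = 1" "e * (e * x) = x" "e * (x * e) = x" "e * x * e = x" for x using e by auto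
  have O: "g \<in> carrier O3"
    using g scaleR_in_O3[OF rot_half_turn_in_O3(1) e] scaleR_in_O3[OF rot_half_turn_in_O3(2) e] by blast
  note s = scaleR_mult_matrix tg rot_half_turn_mult transpose_rot_half_turn ee
  have img: "conj_subgroup g (prism m 0) = prism m \<tau>"
    if "\<And>x. x \<in> prism m 0 \<Longrightarrow> g ** x ** tr g \<in> prism m \<tau>" "\<And>x. x \<in> prism m \<tau> \<Longrightarrow> tr g ** x ** g \<in> prism m 0" for \<tau>
    using that mem_conj_subgroup_iff[OF O] conj_subgroup_matrix[OF O] by auto
  from g show ?thesis
  proof
    assume g: "g = e *\<^sub>R rot e3 t"
    show ?thesis
    proof (rule img)
      show "g ** x ** tr g \<in> prism m (2 * t)" if "x \<in> prism m 0" for x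
        using that
      proof (cases rule: prismE)
        case (1 a i) then show ?thesis using prismI(1)[of a i m "2*t"] by (simp add: g s)
      next
        case (2 a i) then show ?thesis using prismI(2)[of a i m "2*t"] by (simp add: g s add_ac)
      qed
      show "tr g ** x ** g \<in> prism m 0" if "x \<in> prism m (2 * t)" for x
        using that
      proof (cases rule: prismE)
        case (1 a i) then show ?thesis using prismI(1)[of a i m 0] by (simp add: g s)
      next
        case (2 a i) then show ?thesis using prismI(2)[of a i m 0] by (simp add: g s add_ac)
      qed
    qed
  next
    assume g: "g = e *\<^sub>R half_turn t"
    show ?thesis
    proof (rule img)
      show "g ** x ** tr g \<in> prism m (2 * t)" if "x \<in> prism m 0" for x
        using that
      proof (cases rule: prismE)
        case (1 a i) then show ?thesis using prismI(1)[of a "-i" m "2*t"] by (simp add: g s)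
      next
        case (2 a i) then show ?thesis using prismI(2)[of a "-i" m "2*t"] by (simp add: g s algebra_simps)
      qed
      show "tr g ** x ** g \<in> prism m 0" if "x \<in> prism m (2 * t)" for x
        using that
      proof (cases rule: prismE)
        case (1 a i) then show ?thesis using prismI(1)[of a "-i" m 0] by (simp add: g s)
      next
        case (2 a i) then show ?thesis using prismI(2)[of a "-i" m 0] by (simp add: g s algebra_simps)
      qed
    qed
  qed
qed

section \<open>Groups of diagonal sign matrices\<close>

definition diag3 :: "real \<Rightarrow> real \<Rightarrow> real \<Rightarrow> real^3^3" where
  "diag3 a b c = vector [vector [a, 0, 0], vector [0, b, 0], vector [0, 0, c]]"

lemma diag3_eq_iff: "diag3 a b c = diag3 a' b' c' \<longleftrightarrow> a = a' \<and> b = b' \<and> c = c'"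
  by (auto simp: diag3_def vec_eq_iff forall_3)

lemma diag3_mult: "diag3 a b c ** diag3 a' b' c' = diag3 (a * a') (b * b') (c * c')"
  by (simp add: diag3_def mat3)

lemma diag3_uminus: "- diag3 a b c = diag3 (- a) (- b) (- c)"
  by (simp add: diag3_def mat3)

lemma diag3_scaleR: "r *\<^sub>R diag3 a b c = diag3 (r * a) (r * b) (r * c)"
  by (simp add: diag3_def mat3)

lemma diag3_simps: "mat 1 = diag3 1 1 1" "rot e3 pi = diag3 (-1) (-1) 1" "half_turn 0 = diag3 1 (-1) (-1)"
    "half_turn pi = diag3 (-1) 1 (-1)"
   "rot e1 pi = diag3 1 (-1) (-1)"
  by (simp_all add: diag3_def mat3)

lemma diag3_in_O3: "a \<in> {1,-1} \<Longrightarrow> b \<in> {1,-1} \<Longrightarrow> c \<in> {1,-1} \<Longrightarrow> diag3 a b c \<in> carrier O3"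
  by (auto simp: O3_def orthogonal_matrix diag3_def mat3)

text \<open>Permuting the coordinates is an orthogonal change of basis. The swaps of \<open>e1, e3\<close> and of \<open>e1, e2\<close>
generate all permutations, so they suffice to identify the conjugate groups of diagonal matrices.\<close>

lemma conj_class_diag3_swap13:
  assumes "T \<subseteq> {1,-1} \<times> {1,-1} \<times> {1,-1}"
  shows "conj_class ((\<lambda>(a,b,c). diag3 c b a) ` T) = conj_class ((\<lambda>(a,b,c). diag3 a b c) ` T)"
proof (rule conj_class_swap_e1_e3)
  show "(\<lambda>(a,b,c). diag3 a b c) ` T \<subseteq> carrier O3" using assms diag3_in_O3 by auto
  have "(\<chi> i j. diag3 a b c $ Transposition.transpose 1 3 i $ Transposition.transpose 1 3 j)
      = diag3 c b a" for a b c
    by (simp add: diag3_def vec_eq_iff forall_3 Transposition.transpose_def)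
  then show "(\<lambda>(a, b, c). diag3 c b a) ` T =
    (\<lambda>A. \<chi> i j. A $ Transposition.transpose 1 3 i $ Transposition.transpose 1 3 j) ` (\<lambda>(a, b, c). diag3 a b c) ` T"
    unfolding image_image by (intro image_cong refl) (simp split: prod.split)
qed

lemma conj_class_diag3_swap12:
  assumes "T \<subseteq> {1,-1} \<times> {1,-1} \<times> {1,-1}"
  shows "conj_class ((\<lambda>(a,b,c). diag3 b a c) ` T) = conj_class ((\<lambda>(a,b,c). diag3 a b c) ` T)"
proof -
  have g: "rot e3 (pi/2) \<in> carrier O3" by (rule rot_half_turn_in_O3)
  have "rot e3 (pi/2) ** diag3 a b c ** tr (rot e3 (pi/2)) = diag3 b a c" for a b c
    by (simp add: diag3_def mat3)
  then have "(\<lambda>(a,b,c). diag3 b a c) ` T = conj_subgroup (rot e3 (pi/2)) ((\<lambda>(a,b,c). diag3 a b c) ` T)"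
    unfolding conj_subgroup_matrix[OF g] image_image by (intro image_cong refl) (simp split: prod.split)
  moreover have "(\<lambda>(a,b,c). diag3 a b c) ` T \<subseteq> carrier O3" using assms diag3_in_O3 by auto
  ultimately show ?thesis using conj_class_conj_subgroup[OF g] by simp
qed

text \<open>The Klein four-group of half-turns about the coordinate axes, twisted by the sign character with
value \<open>\<epsilon>\<close> on the axis \<open>e3\<close> and \<open>\<delta>\<close> on the axis \<open>e1\<close>.\<close>

definition klein :: "real \<Rightarrow> real \<Rightarrow> (real^3^3) set" where
  "klein \<epsilon> \<delta> = {mat 1, \<epsilon> *\<^sub>R rot e3 pi, \<delta> *\<^sub>R rot e1 pi, (\<epsilon> * \<delta>) *\<^sub>R half_turn pi}"

lemma Z2_minus_1: "Z2_minus 1 = {mat 1, - rot e3 pi}"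
  unfolding Z2_minus_def Z_gp_1 trivial_gp_def l_coset_O3 by auto

lemma D_gp_2: "D_gp 2 = klein 1 1"
proof -
  have eq: "rot e3 (2 * pi * of_int (2 * j) / real 2) = rot e3 0"
      "half_turn (2 * pi * of_int (2 * j) / real 2) = half_turn 0"
    "rot e3 (2 * pi * of_int (2 * j + 1) / real 2) = rot e3 pi"
        "half_turn (2 * pi * of_int (2 * j + 1) / real 2) = half_turn pi" for j :: int
    unfolding rot_eq_iff half_turn_eq_iff by (rule exI[of _ j], simp add: algebra_simps)+
  have "range (\<lambda>j::int. rot e3 (2 * pi * of_int j / real 2)) = {rot e3 0} \<union> {rot e3 pi}"
    unfolding range_int_even_odd[of "\<lambda>j. rot e3 (2 * pi * of_int j / real 2)"] eq
        by (simp only: image_constant_conv) simp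
  moreover have "range (\<lambda>j::int. half_turn (2 * pi * of_int j / real 2)) = {half_turn 0} \<union> {half_turn pi}"
    unfolding range_int_even_odd[of "\<lambda>j. half_turn (2 * pi * of_int j / real 2)"] eq
        by (simp only: image_constant_conv) simp
  ultimately have "D_gp 2 = {rot e3 0, rot e3 pi, half_turn 0, half_turn pi}"
    unfolding D_gp_eq[OF one_le_numeral] by blast
  then show ?thesis
    by (simp add: klein_def rot_e3_0 half_turn_0)
qed

lemma D_z_2: "D_z 2 = klein 1 (-1)"
  unfolding D_z_def Z_gp_2 klein_def l_coset_O3
      by (auto simp: diag3_simps diag3_uminus diag3_scaleR diag3_mult)

text \<open>A nontrivial sign character of the Klein four-group is determined by the one axis on which it is
positive, and permuting the coordinates moves that axis to any other.\<close>

lemma conj_class_klein: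
  assumes "\<epsilon> \<in> {1,-1}" "\<delta> \<in> {1,-1}"
  shows "conj_class (klein \<epsilon> \<delta>) = (if \<epsilon> = 1 \<and> \<delta> = 1 then conj_class (D_gp 2) else conj_class (D_z 2))"
proof -
  have k: "klein 1 (-1) = {diag3 1 1 1, diag3 (-1) (-1) 1, diag3 (-1) 1 1, diag3 1 (-1) 1}"
    "klein (-1) 1 = {diag3 1 1 1, diag3 1 1 (-1), diag3 1 (-1) (-1), diag3 1 (-1) 1}"
    "klein (-1) (-1) = {diag3 1 1 1, diag3 1 1 (-1), diag3 (-1) 1 1, diag3 (-1) 1 (-1)}"
    by (simp_all add: klein_def diag3_simps diag3_scaleR)
  have 1: "conj_class (klein (-1) 1) = conj_class (klein 1 (-1))"
    using conj_class_diag3_swap13[of "{(1,1,1),(-1,-1,1),(-1,1,1),(1,-1,1)}"]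
    unfolding k by (simp add: insert_commute)
  have 2: "conj_class (klein (-1) (-1)) = conj_class (klein (-1) 1)"
    using conj_class_diag3_swap12[of "{(1,1,1),(1,1,-1),(1,-1,-1),(1,-1,1)}"]
    unfolding k by (simp add: insert_commute)
  show ?thesis using assms by (elim insertE emptyE) (simp_all add: D_gp_2 D_z_2 1 2)
qed

lemma conj_class_two_elements:
  assumes "x = diag3 a b c" "a \<in> {1,-1}" "b \<in> {1,-1}" "c \<in> {1,-1}" "x \<noteq> mat 1" "x \<noteq> - mat 1"
  shows "conj_class {mat 1, x} \<in> {conj_class (Z_gp 2), conj_class (Z2_minus 1)}"
proof -
  have Z: "Z_gp 2 = {diag3 1 1 1, diag3 (-1) (-1) 1}" "Z2_minus 1 = {diag3 1 1 1, diag3 1 1 (-1)}"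
    unfolding Z_gp_2 Z2_minus_1 diag3_simps diag3_uminus by simp_all
  have 3: "conj_class {diag3 1 1 1, diag3 c b a} = conj_class {diag3 1 1 1, diag3 a b c}"
     if "a \<in> {1,-1}" "b \<in> {1,-1}" "c \<in> {1,-1}" for a b c
  proof -
    have "{(1,1,1),(a,b,c)} \<subseteq> {1,-1} \<times> {1,-1} \<times> {1,-1::real}" using that by blast
    from conj_class_diag3_swap13[OF this] show ?thesis by simp
  qed
  have 2: "conj_class {diag3 1 1 1, diag3 b a c} = conj_class {diag3 1 1 1, diag3 a b c}"
     if "a \<in> {1,-1}" "b \<in> {1,-1}" "c \<in> {1,-1}" for a b c
  proof -
    have "{(1,1,1),(a,b,c)} \<subseteq> {1,-1} \<times> {1,-1} \<times> {1,-1::real}" using that by blast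
    from conj_class_diag3_swap12[OF this] show ?thesis by simp
  qed
  have "conj_class {diag3 1 1 1, diag3 1 (-1) (-1)} = conj_class {diag3 1 1 1, diag3 (-1) (-1) 1}"
     "conj_class {diag3 1 1 1, diag3 (-1) 1 (-1)} = conj_class {diag3 1 1 1, diag3 (-1) (-1) 1}"
     "conj_class {diag3 1 1 1, diag3 (-1) 1 1} = conj_class {diag3 1 1 1, diag3 1 1 (-1)}"
     "conj_class {diag3 1 1 1, diag3 1 (-1) 1} = conj_class {diag3 1 1 1, diag3 1 1 (-1)}"
    using 3[of "-1" "-1" 1] 2[of 1 "-1" "-1"] 3[of 1 1 "-1"] 2[of "-1" 1 1] by simp_all
  then show ?thesis unfolding Z using assms by (auto simp: diag3_simps diag3_uminus diag3_eq_iff)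
qed

abbreviation diag_signs :: "(real^3^3) set" where
  "diag_signs \<equiv> {diag3 a b c | a b c. a \<in> {1,-1} \<and> b \<in> {1,-1} \<and> c \<in> {1,-1}}"

text \<open>The diagonal sign matrices are the union of \<open>klein \<epsilon> \<delta>\<close> and its negative. An element of \<open>S\<close> in the
negative part would produce \<open>-1\<close> when multiplied by its opposite.\<close>

lemma klein_if_two_axes:
  assumes S: "S \<subseteq> diag_signs" "mult_closed S" "mat 1 \<in> S" "- mat 1 \<notin> S"
    and ed: "\<epsilon> \<in> {1,-1}" "\<delta> \<in> {1,-1}" "\<epsilon> *\<^sub>R rot e3 pi \<in> S" "\<delta> *\<^sub>R rot e1 pi \<in> S"
  shows "S = klein \<epsilon> \<delta>"
proof
  have "(\<epsilon> *\<^sub>R rot e3 pi) ** (\<delta> *\<^sub>R rot e1 pi) \<in> S" using S(2) ed unfolding mult_closed_def by blast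
  then show *: "klein \<epsilon> \<delta> \<subseteq> S"
    using S(3) ed by (simp add: klein_def scaleR_mult_matrix half_turn_def mult.commute)
  show "S \<subseteq> klein \<epsilon> \<delta>"
  proof
    fix x assume x: "x \<in> S"
    then obtain a b c where abc: "x = diag3 a b c" "a \<in> {1,-1}" "b \<in> {1,-1}" "c \<in> {1,-1}" using S(1) by blast
    have d: "a = 1 \<or> a = -1" "b = 1 \<or> b = -1" "c = 1 \<or> c = -1" "\<epsilon> = 1 \<or> \<epsilon> = -1" "\<delta> = 1 \<or> \<delta> = -1"
      using abc(2-4) ed(1,2) by simp_all
    have "x \<in> klein \<epsilon> \<delta> \<or> - x \<in> klein \<epsilon> \<delta>"
      unfolding abc(1) klein_def diag3_simps diag3_uminus diag3_scaleR insert_iff empty_iff diag3_eq_iff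
      using d by (elim disjE; simp)
    moreover have "- x \<notin> S"
    proof
      assume "- x \<in> S"
      then have "x ** (- x) \<in> S" using x S(2) unfolding mult_closed_def by blast
      moreover have "x ** (- x) = - mat 1"
        unfolding abc(1) diag3_uminus diag3_mult diag3_simps diag3_eq_iff using d(1-3) by (elim disjE; simp)
      ultimately show False using S(4) by simp
    qed
    ultimately show "x \<in> klein \<epsilon> \<delta>" using * by blast
  qed
qed

text \<open>Apart from \<open>1\<close> and \<open>-1\<close>, a diagonal sign matrix is up to sign the half-turn about one coordinate axis.
Two that belong to different axes have a product belonging to the third.\<close>

lemma third_axis:
  assumes x: "x \<in> diag_signs" "x \<noteq> mat 1" "x \<noteq> - mat 1" and y: "y \<in> diag_signs" "y \<noteq> mat 1" "y \<noteq> - mat 1"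
    and xy: "x \<noteq> y" "x \<noteq> - y"
    and v: "v \<in> {rot e3 pi, rot e1 pi}"
  shows "v \<in> {x, y, x ** y} \<or> - v \<in> {x, y, x ** y}"
proof -
  have *: "z \<in> {diag3 (-1) (-1) 1, diag3 1 1 (-1), diag3 1 (-1) (-1), diag3 (-1) 1 1, diag3 1 (-1) 1, diag3 (-1) 1 (-1)}"
    if z: "z \<in> diag_signs" "z \<noteq> mat 1" "z \<noteq> - mat 1" for z
  proof -
    obtain a b c where "z = diag3 a b c" "a \<in> {1,-1}" "b \<in> {1,-1}" "c \<in> {1,-1}" using z(1) by blast
    then show ?thesis using z(2,3) unfolding diag3_simps diag3_uminus diag3_eq_iff insert_iff
        by (elim disjE; simp)
  qed
  show ?thesis
    using *[OF x] *[OF y] xy v unfolding diag3_simps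
    by (elim insertE emptyE) (simp_all add: diag3_uminus diag3_mult diag3_eq_iff)
qed

lemma diag_signs_square: "x \<in> diag_signs \<Longrightarrow> x ** x = mat 1"
  by (auto simp: diag3_mult diag3_simps)

text \<open>Two distinct elements other than \<open>1\<close> belong to different axes, since otherwise they would be opposite
and their product would be \<open>-1\<close>. By \<open>third_axis\<close>, every axis then has an element of \<open>S\<close>.\<close>

lemma diag_signs_subgroup_cases:
  assumes S: "S \<subseteq> diag_signs" "mult_closed S" "mat 1 \<in> S" "- mat 1 \<notin> S"
  shows "conj_class S \<in> {conj_class trivial_gp, conj_class (Z_gp 2), conj_class (Z2_minus 1)} \<or>
     (\<exists>\<epsilon> \<delta>. \<epsilon> \<in> {1,-1} \<and> \<delta> \<in> {1,-1} \<and> S = klein \<epsilon> \<delta>)"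
proof -
  have ne: "z \<noteq> - mat 1" if "z \<in> S" for z using that S(4) by blast
  show ?thesis
  proof (cases "\<exists>x y. x \<in> S \<and> y \<in> S \<and> x \<noteq> mat 1 \<and> y \<noteq> mat 1 \<and> x \<noteq> y")
    case True
    then obtain x y where xy: "x \<in> S" "y \<in> S" "x \<noteq> mat 1" "y \<noteq> mat 1" "x \<noteq> y" by blast
    have xyS: "x ** y \<in> S" using xy(1,2) S(2) unfolding mult_closed_def by blast
    have "x \<noteq> - y"
    proof
      assume "x = - y"
      moreover have "y ** y = mat 1" using xy(2) S(1) by (intro diag_signs_square) (rule subsetD)
      ultimately have "x ** y = - mat 1" by (simp only: neg_mult_matrix)
      then show False using ne[OF xyS] by simp
    qed
    note third = third_axis[OF _ xy(3) ne[OF xy(1)] _ xy(4) ne[OF xy(2)] xy(5) this]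
    have sub: "{x, y, x ** y} \<subseteq> S" using xy(1,2) xyS by simp
    have signed: "\<exists>\<epsilon>. \<epsilon> \<in> {1,-1::real} \<and> \<epsilon> *\<^sub>R v \<in> S" if v: "v \<in> {rot e3 pi, rot e1 pi}" for v
    proof -
      have "v \<in> {x, y, x ** y} \<or> - v \<in> {x, y, x ** y}"
        using xy(1,2) S(1) v by (intro third) (erule (1) subsetD | assumption)+
      then show ?thesis
      proof
        assume "v \<in> {x, y, x ** y}" then show ?thesis using sub by (intro exI[of _ 1]) auto
      next
        assume "- v \<in> {x, y, x ** y}" then show ?thesis using sub by (intro exI[of _ "-1"]) auto
      qed
    qed
    obtain \<epsilon> where \<epsilon>: "\<epsilon> \<in> {1,-1::real}" "\<epsilon> *\<^sub>R rot e3 pi \<in> S" using signed[of "rot e3 pi"] by blast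
    obtain \<delta> where \<delta>: "\<delta> \<in> {1,-1::real}" "\<delta> *\<^sub>R rot e1 pi \<in> S" using signed[of "rot e1 pi"] by blast
    show ?thesis using klein_if_two_axes[OF S \<epsilon>(1) \<delta>(1) \<epsilon>(2) \<delta>(2)] \<epsilon>(1) \<delta>(1) by blast
  next
    case False
    show ?thesis
    proof (cases "\<exists>x\<in>S. x \<noteq> mat 1")
      case True
      then obtain x where x: "x \<in> S" "x \<noteq> mat 1" by blast
      have "z \<in> {mat 1, x}" if "z \<in> S" for z
      proof (rule ccontr)
        assume "z \<notin> {mat 1, x}"
        then have "x \<in> S \<and> z \<in> S \<and> x \<noteq> mat 1 \<and> z \<noteq> mat 1 \<and> x \<noteq> z" using x that by auto
        with False show False by (elim notE) (intro exI)
      qed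
      then have "S \<subseteq> {mat 1, x}" by (rule subsetI)
      moreover have "{mat 1, x} \<subseteq> S" using x(1) S(3) by simp
      ultimately have "S = {mat 1, x}" by (rule subset_antisym)
      moreover obtain a b c where abc: "x = diag3 a b c" "a \<in> {1,-1}" "b \<in> {1,-1}"
          "c \<in> {1,-1}" using S(1) x(1) by blast
      ultimately show ?thesis using conj_class_two_elements[OF abc x(2) ne[OF x(1)]]
          by (simp only: insert_iff) blast
    next
      case False
      then have "S \<subseteq> {mat 1}" by blast
      then have "S = trivial_gp" using S(3) unfolding trivial_gp_def by blast
      then show ?thesis by simp
    qed
  qed
qed

section \<open>Coaxial intersections\<close>

text \<open>The arithmetic behind the distinction by the parity of \<open>m/d\<close>: dividing by \<open>d\<close> turns \<open>2n dvd ml\<close> into a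
divisibility between coprime numbers. Either the factor \<open>2\<close> is absorbed by \<open>m/d\<close>, and then \<open>n/d\<close> is
odd, or it remains on the left.\<close>

lemma double_dvd_iff:
  assumes m: "m \<ge> 1" and n: "n \<ge> 1" and d: "d = gcd m n"
  shows "even (m div d) \<Longrightarrow> odd (n div d)"
    "even (m div d) \<Longrightarrow> 2 * int n dvd int m * l \<longleftrightarrow> int (n div d) dvd l"
    "odd (m div d) \<Longrightarrow> 2 * int n dvd int m * l \<longleftrightarrow> int (2 * (n div d)) dvd l"
proof -
  define p q where "p = m div d" and "q = n div d"
  have d0: "d > 0" using m d by simp
  have mn: "m = d * p" "n = d * q" using d by (simp_all add: p_def q_def)
  have cop: "coprime p q" unfolding p_def q_def d using m n by (intro div_gcd_coprime) auto
  then have copi: "coprime (int q) (int p)" by (simp add: coprime_commute)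
  have *: "2 * int n dvd int m * l \<longleftrightarrow> 2 * int q dvd int p * l"
    using d0 unfolding mn by (simp add: mult.left_commute[of 2] mult.assoc)
  show "odd (n div d)" if "even (m div d)"
    using coprime_common_divisor[OF cop, of 2] that unfolding p_def[symmetric] q_def[symmetric] by auto
  show "2 * int n dvd int m * l \<longleftrightarrow> int (n div d) dvd l" if "even (m div d)"
  proof -
    have "even p" using that by (simp only: p_def)
    then obtain r where r: "p = 2 * r" by (rule evenE)
    have "coprime (int q) (int r)" using copi r by simp
    then show ?thesis unfolding * q_def[symmetric] r by (simp add: mult.assoc coprime_dvd_mult_right_iff)
  qed
  show "2 * int n dvd int m * l \<longleftrightarrow> int (2 * (n div d)) dvd l" if "odd (m div d)"
  proof -
    have "coprime (2 * int q) (int p)" using copi that unfolding p_def[symmetric] by simp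
    then show ?thesis unfolding * q_def[symmetric] by (simp add: coprime_dvd_mult_right_iff)
  qed
qed

lemma angle_eq_iff:
  assumes "m \<ge> 1" "n \<ge> 1"
  shows "pi * of_int j / real n = 2 * pi * of_int i / real m \<longleftrightarrow> int m * j = 2 * int n * i"
proof -
  have "pi * of_int j / real n = 2 * pi * of_int i / real m
      \<longleftrightarrow> real_of_int (int m * j) = real_of_int (2 * int n * i)"
    using assms by (simp add: field_simps)
  then show ?thesis by (simp only: of_int_eq_iff)
qed

text \<open>Matching the two families determines the sign, and the angles must agree up to a full turn. That
turn can be absorbed into the index \<open>i\<close>, because the angles of the prism are only defined modulo \<open>m\<close>
steps.\<close>

lemma D2_d_Int_prism:
  assumes m: "m \<ge> 1" and n: "n \<ge> 1"
  shows "D2_d n \<inter> prism m \<tau> =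
     {alt_sign j *\<^sub>R rot e3 (pi * j / n) | j::int. 2 * int n dvd int m * j} \<union>
     {alt_sign j *\<^sub>R half_turn (pi * j / n) | j::int. \<exists>i::int. pi * j / n = 2 * pi * i / m + \<tau>}" (is "?L = ?A \<union> ?B")
proof
  have shift: "2 * pi * i / m + t + 2 * pi * k = 2 * pi * of_int (i + int m * k) / m + t" for i k :: int and t
    using m by (simp add: field_simps)
  show "?L \<subseteq> ?A \<union> ?B"
  proof
    fix x assume "x \<in> ?L"
    then have x: "x \<in> prism m \<tau>" "x \<in> D2_d n" by auto
    from x(2)[unfolded D2_d_eq[OF n]] obtain j
        where j: "x = alt_sign j *\<^sub>R rot e3 (pi * j / n) \<or> x = alt_sign j *\<^sub>R half_turn (pi * j / n)" by blast
    show "x \<in> ?A \<union> ?B" using x(1)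
    proof (cases rule: prismE)
      case (1 a i)
      then have xj: "x = alt_sign j *\<^sub>R rot e3 (pi * j / n)" "rot e3 (pi * j / n) = rot e3 (2 * pi * i / m)"
        using j alt_sign(1)[of j] by (auto simp: signed_rot_half_turn_eq)
      then obtain k :: int where "pi * j / n = 2 * pi * i / m + 2 * pi * k" unfolding rot_eq_iff by blast
      then have "pi * j / n = 2 * pi * of_int (i + int m * k) / m" using shift[of i 0 k] by simp
      then have "2 * int n dvd int m * j" unfolding angle_eq_iff[OF m n] by simp
      then show ?thesis using xj(1) by blast
    next
      case (2 a i)
      then have xj: "x = alt_sign j *\<^sub>R half_turn (pi * j / n)"
          "half_turn (pi * j / n) = half_turn (2 * pi * i / m + \<tau>)"
        using j alt_sign(1)[of j] by (auto simp: signed_rot_half_turn_eq)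
      then obtain k :: int where "pi * j / n = 2 * pi * i / m + \<tau> + 2 * pi * k" unfolding half_turn_eq_iff
          by blast
      then have "\<exists>i::int. pi * j / n = 2 * pi * i / m + \<tau>" using shift[of i \<tau> k]
          by (intro exI[of _ "i + int m * k"]) simp
      then show ?thesis using xj(1) by blast
    qed
  qed
  show "?A \<union> ?B \<subseteq> ?L"
  proof
    fix x assume x: "x \<in> ?A \<union> ?B"
    then have "x \<in> D2_d n" unfolding D2_d_eq[OF n] by blast
    moreover have "x \<in> prism m \<tau>"
      using x
    proof
      assume "x \<in> ?A"
      then obtain j :: int where j: "x = alt_sign j *\<^sub>R rot e3 (pi * j / n)" "2 * int n dvd int m * j"
          by blast
      then obtain i where "int m * j = 2 * int n * i" by blast
      then have "pi * j / n = 2 * pi * i / m" using angle_eq_iff[OF m n] by blast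
      then show ?thesis using prismI(1)[OF alt_sign(1)] j(1) by simp
    next
      assume "x \<in> ?B"
      then obtain j i :: int where j: "x = alt_sign j *\<^sub>R half_turn (pi * j / n)"
          "pi * j / n = 2 * pi * i / m + \<tau>" by blast
      then show ?thesis using prismI(2)[OF alt_sign(1)] by simp
    qed
    ultimately show "x \<in> ?L" by blast
  qed
qed

text \<open>As soon as one horizontal axis is common, the indices of the common half-turns form a coset of
those of the common rotations.\<close>

lemma coaxial_half_turns:
  assumes m: "m \<ge> 1" and n: "n \<ge> 1" and j0: "pi * of_int j0 / n = 2 * pi * of_int i0 / m + \<tau>"
  shows "(\<exists>i::int. pi * of_int j / real n = 2 * pi * of_int i / real m + \<tau>) \<longleftrightarrow> 2 * int n dvd int m * (j - j0)"
proof -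
  have "pi * of_int j / real n = 2 * pi * of_int i / real m + \<tau>
      \<longleftrightarrow> pi * of_int (j - j0) / real n = 2 * pi * of_int (i - i0) / real m" for i
    using j0 by (simp add: diff_divide_distrib right_diff_distrib) linarith
  then have "(\<exists>i. pi * of_int j / real n = 2 * pi * of_int i / real m + \<tau>)
      \<longleftrightarrow> (\<exists>i. int m * (j - j0) = 2 * int n * (i - i0))"
    unfolding angle_eq_iff[OF m n] by simp
  also have "\<dots> \<longleftrightarrow> 2 * int n dvd int m * (j - j0)"
  proof
    assume "\<exists>i. int m * (j - j0) = 2 * int n * (i - i0)"
    then show "2 * int n dvd int m * (j - j0)" by (elim exE) (rule dvdI)
  next
    assume "2 * int n dvd int m * (j - j0)"
    then obtain k where "int m * (j - j0) = 2 * int n * k" by (rule dvdE)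
    then show "\<exists>i. int m * (j - j0) = 2 * int n * (i - i0)" by (intro exI[of _ "k + i0"]) simp
  qed
  finally show ?thesis .
qed

text \<open>Turning the common axis with index \<open>j0\<close> into the direction of \<open>e1\<close> leaves the rotations unchanged and
shifts the indices of the half-turns by \<open>j0\<close>, so that only the overall sign \<open>(-1)^j0\<close> is left.\<close>

lemma coaxial_intersection:
  assumes m: "m \<ge> 1" and n: "n \<ge> 1" and j0: "pi * of_int j0 / n = 2 * pi * of_int i0 / m + \<tau>"
  shows "conj_class (D2_d n \<inter> prism m \<tau>) = conj_class (
     {alt_sign l *\<^sub>R rot e3 (pi * l / n) | l::int. 2 * int n dvd int m * l} \<union>
     {(alt_sign j0 * alt_sign l) *\<^sub>R half_turn (pi * l / n) | l::int. 2 * int n dvd int m * l})" (is "_ = conj_class (?A \<union> ?B)")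
proof -
  define t where "t = pi * j0 / (2 * n)"
  have conj: "rot e3 t ** (a *\<^sub>R rot e3 s) ** tr (rot e3 t) = a *\<^sub>R rot e3 s"
     "rot e3 t ** (a *\<^sub>R half_turn s) ** tr (rot e3 t) = a *\<^sub>R half_turn (s + 2 * t)" for a s
    by (simp_all add: scaleR_mult_matrix transpose_rot_half_turn rot_half_turn_mult add_ac)
  have t2: "pi * l / n + 2 * t = pi * of_int (j0 + l) / n" for l :: int
    using n by (simp add: t_def field_simps)
  have "conj_subgroup (rot e3 t) ?A = ?A"
    unfolding conj_subgroup_matrix[OF rot_half_turn_in_O3(1)] setcompr_eq_image image_image conj ..
  moreover have "conj_subgroup (rot e3 t) ?B
      = {alt_sign j *\<^sub>R half_turn (pi * j / n) | j::int. \<exists>i::int. pi * j / n = 2 * pi * i / m + \<tau>}"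
    unfolding conj_subgroup_matrix[OF rot_half_turn_in_O3(1)] setcompr_eq_image image_image conj t2 coaxial_half_turns[OF m n j0]
  proof (intro Set.set_eqI iffI)
    fix x assume "x \<in> (\<lambda>l. (alt_sign j0 * alt_sign l) *\<^sub>R half_turn (pi * of_int (j0 + l) / n)) ` {l. 2 * int n dvd int m * l}"
    then obtain l :: int where "x = (alt_sign j0 * alt_sign l) *\<^sub>R half_turn (pi * of_int (j0 + l) / n)"
        "2 * int n dvd int m * l" by blast
    then show "x \<in> (\<lambda>j. alt_sign j *\<^sub>R half_turn (pi * of_int j / n)) ` {j. 2 * int n dvd int m * (j - j0)}"
      by (intro image_eqI[of _ _ "j0 + l"]) (simp_all add: alt_sign(2))
  next
    fix x assume "x \<in> (\<lambda>j. alt_sign j *\<^sub>R half_turn (pi * of_int j / n)) ` {j. 2 * int n dvd int m * (j - j0)}"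
    then obtain j :: int where "x = alt_sign j *\<^sub>R half_turn (pi * of_int j / n)"
        "2 * int n dvd int m * (j - j0)" by blast
    then show "x \<in> (\<lambda>l. (alt_sign j0 * alt_sign l) *\<^sub>R half_turn (pi * of_int (j0 + l) / n)) ` {l. 2 * int n dvd int m * l}"
      by (intro image_eqI[of _ _ "j - j0"]) (simp_all add: alt_sign_def)
  qed
  ultimately have eq: "conj_subgroup (rot e3 t) (?A \<union> ?B) = D2_d n \<inter> prism m \<tau>"
    unfolding D2_d_Int_prism[OF m n] conj_subgroup_eq image_Un by (simp only:)
  have "?A \<subseteq> carrier O3" by (clarify, rule scaleR_in_O3[OF rot_half_turn_in_O3(1) alt_sign(1)])
  moreover have "?B \<subseteq> carrier O3"
    unfolding alt_sign(2) by (clarify, rule scaleR_in_O3[OF rot_half_turn_in_O3(2) alt_sign(1)])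
  ultimately have "?A \<union> ?B \<subseteq> carrier O3" by (rule Un_least)
  from conj_class_conj_subgroup[OF rot_half_turn_in_O3(1)[of t] this] show ?thesis unfolding eq .
qed

text \<open>The admissible indices are the multiples of \<open>n/d\<close> or of \<open>2n/d\<close>; reindexing by the quotient gives the
standard groups. In the first case the sign survives because \<open>n/d\<close> is odd.\<close>

lemma coaxial_groups:
  assumes m: "m \<ge> 1" and n: "n \<ge> 1" and d: "d = gcd m n"
  defines "I \<equiv> {l::int. 2 * int n dvd int m * l}"
  shows "even (m div d) \<Longrightarrow> (\<lambda>l. alt_sign l *\<^sub>R rot e3 (pi * l / n)) ` I = Z2_minus d"
    "even (m div d)
        \<Longrightarrow> (\<lambda>l. alt_sign l *\<^sub>R rot e3 (pi * l / n)) ` I \<union> (\<lambda>l. alt_sign l *\<^sub>R half_turn (pi * l / n)) ` I = D2_d d"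
    "odd (m div d) \<Longrightarrow> (\<lambda>l. alt_sign l *\<^sub>R rot e3 (pi * l / n)) ` I = Z_gp d"
    "odd (m div d)
        \<Longrightarrow> (\<lambda>l. alt_sign l *\<^sub>R rot e3 (pi * l / n)) ` I \<union> (\<lambda>l. alt_sign l *\<^sub>R half_turn (pi * l / n)) ` I = D_gp d"
    "odd (m div d)
        \<Longrightarrow> (\<lambda>l. alt_sign l *\<^sub>R rot e3 (pi * l / n)) ` I \<union> (\<lambda>l. - (alt_sign l *\<^sub>R half_turn (pi * l / n))) ` I = D_z d"
proof -
  define q where "q = n div d"
  have d1: "d \<ge> 1" using m d by (simp add: Suc_le_eq)
  have nq: "real n = real d * real q" unfolding q_def using d
      by (metis dvd_mult_div_cancel gcd_dvd2 of_nat_mult)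
  have q0: "real q > 0" using nq n by (cases "q = 0") auto
  have angle: "pi * real_of_int (int q * j) / real n = pi * j / d"
    "pi * real_of_int (int (2 * q) * j) / real n = 2 * pi * j / d" for j :: int
    unfolding nq using q0 by simp_all
  have even: "I = range (\<lambda>j. int q * j)" "alt_sign (int q * j) = alt_sign j" if "even (m div d)" for j
    using double_dvd_iff(1)[OF m n d that]
    by (auto simp: I_def double_dvd_iff(2)[OF m n d that] q_def[symmetric] alt_sign_def elim!: dvdE)
  have odd: "I = range (\<lambda>j. int (2 * q) * j)" "alt_sign (int (2 * q) * j) = 1" if "odd (m div d)" for j
    by (auto simp: I_def double_dvd_iff(3)[OF m n d that] q_def[symmetric] alt_sign_def elim!: dvdE)
  show "(\<lambda>l. alt_sign l *\<^sub>R rot e3 (pi * l / n)) ` I = Z2_minus d"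
    "(\<lambda>l. alt_sign l *\<^sub>R rot e3 (pi * l / n)) ` I \<union> (\<lambda>l. alt_sign l *\<^sub>R half_turn (pi * l / n)) ` I = D2_d d"
        if "even (m div d)"
    unfolding even(1)[OF that] image_image angle even(2)[OF that] Z2_minus_eq[OF d1] D2_d_eq[OF d1]
        by (rule refl)+
  show "(\<lambda>l. alt_sign l *\<^sub>R rot e3 (pi * l / n)) ` I = Z_gp d"
    "(\<lambda>l. alt_sign l *\<^sub>R rot e3 (pi * l / n)) ` I \<union> (\<lambda>l. alt_sign l *\<^sub>R half_turn (pi * l / n)) ` I = D_gp d"
    "(\<lambda>l. alt_sign l *\<^sub>R rot e3 (pi * l / n)) ` I \<union> (\<lambda>l. - (alt_sign l *\<^sub>R half_turn (pi * l / n))) ` I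
        = D_z d" if "odd (m div d)"
    unfolding odd(1)[OF that] image_image angle odd(2)[OF that] Z_gp_eq[OF d1] D_gp_eq[OF d1] D_z_eq[OF d1] scaleR_one by (rule refl)+
qed

text \<open>The witnesses are \<open>\<tau> = 0\<close>, which aligns an axis of positive sign, \<open>\<tau> = \<pi>/n\<close>, which aligns one of
negative sign, and half of \<open>\<pi>/(nm)\<close>. The parameters of the two families of half-turns differ by
multiples of \<open>\<pi>/(nm)\<close>, so the last choice leaves no common axis.\<close>

lemma coaxial_classes:
  assumes m: "m \<ge> 1" and n: "n \<ge> 1" and d: "d = gcd m n"
  shows "range (\<lambda>\<tau>. conj_class (D2_d n \<inter> prism m \<tau>)) =
    (if even (m div d) then {conj_class (Z2_minus d), conj_class (D2_d d)}
     else {conj_class (Z_gp d), conj_class (D_gp d), conj_class (D_z d)})" (is "range ?c = ?R")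
proof -
  define I where "I = {l::int. 2 * int n dvd int m * l}"
  note groups = coaxial_groups[OF assms, folded I_def]
  have A: "{alt_sign l *\<^sub>R rot e3 (pi * l / n) | l::int. 2 * int n dvd int m * l}
      = (\<lambda>l. alt_sign l *\<^sub>R rot e3 (pi * l / n)) ` I"
    by (auto simp: I_def)
  have c: "?c \<tau> = conj_class ((\<lambda>l. alt_sign l *\<^sub>R rot e3 (pi * l / n)) ` I
      \<union> (\<lambda>l. (alt_sign j0 * alt_sign l) *\<^sub>R half_turn (pi * l / n)) ` I)"
    if "pi * of_int j0 / n = 2 * pi * of_int i0 / m + \<tau>" for \<tau> and j0 i0 :: int
    unfolding coaxial_intersection[OF m n that] I_def setcompr_eq_image ..
  have c_empty: "?c \<tau> = conj_class ((\<lambda>l. alt_sign l *\<^sub>R rot e3 (pi * l / n)) ` I)"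
    if "\<And>j i :: int. pi * of_int j / n \<noteq> 2 * pi * of_int i / m + \<tau>" for \<tau>
    unfolding D2_d_Int_prism[OF m n] A using that by simp
  have c_even: "?c \<tau> = conj_class ((\<lambda>l. alt_sign l *\<^sub>R rot e3 (pi * l / n)) ` I
      \<union> (\<lambda>l. alt_sign l *\<^sub>R half_turn (pi * l / n)) ` I)"
    if "pi * of_int j0 / n = 2 * pi * of_int i0 / m + \<tau>" "even j0" for \<tau> and j0 i0 :: int
    using c[OF that(1)] that(2) by (simp add: alt_sign_def)
  have c_odd: "?c \<tau> = conj_class ((\<lambda>l. alt_sign l *\<^sub>R rot e3 (pi * l / n)) ` I
      \<union> (\<lambda>l. - (alt_sign l *\<^sub>R half_turn (pi * l / n))) ` I)"
    if "pi * of_int j0 / n = 2 * pi * of_int i0 / m + \<tau>" "odd j0" for \<tau> and j0 i0 :: int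
    using c[OF that(1)] that(2) by (simp add: alt_sign_def)
  have generic: "?c (pi / (2 * real n * real m)) = conj_class ((\<lambda>l. alt_sign l *\<^sub>R rot e3 (pi * l / n)) ` I)"
  proof (rule c_empty)
    fix j i :: int
    show "pi * of_int j / n \<noteq> 2 * pi * of_int i / m + pi / (2 * real n * real m)"
    proof
      assume "pi * of_int j / n = 2 * pi * of_int i / m + pi / (2 * real n * real m)"
      then have "pi * real_of_int (2 * int m * j) = pi * real_of_int (4 * int n * i + 1)"
        using m n by (simp add: field_simps)
      then have "real_of_int (2 * int m * j) = real_of_int (4 * int n * i + 1)"
        unfolding mult_left_cancel[OF pi_neq_zero] .
      then have "2 * int m * j = 4 * int n * i + 1" by (simp only: of_int_eq_iff)
      from arg_cong[OF this, of even] show False by simp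
    qed
  qed
  have zero: "?c 0 = conj_class ((\<lambda>l. alt_sign l *\<^sub>R rot e3 (pi * l / n)) ` I
      \<union> (\<lambda>l. alt_sign l *\<^sub>R half_turn (pi * l / n)) ` I)"
    by (rule c_even[of 0 0]) simp_all
  have one: "?c (pi / n) = conj_class ((\<lambda>l. alt_sign l *\<^sub>R rot e3 (pi * l / n)) ` I
      \<union> (\<lambda>l. - (alt_sign l *\<^sub>R half_turn (pi * l / n))) ` I)"
    by (rule c_odd[of 1 0]) simp_all
  show ?thesis
  proof (cases "even (m div d)")
    case True
    have "?c \<tau> \<in> ?R" for \<tau>
    proof (cases "\<exists>j i :: int. pi * of_int j / n = 2 * pi * of_int i / m + \<tau>")
      case False
      then show ?thesis using c_empty[of \<tau>] groups(1)[OF True] True by simp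
    next
      case ex: True
      then obtain j i :: int where ji: "pi * of_int j / n = 2 * pi * of_int i / m + \<tau>" by blast
      \<comment> \<open>Replacing \<open>j\<close> by \<open>j + n/d\<close> changes its parity, so some common half-turn has sign plus.\<close>
      have "2 * int n dvd int m * (j + int (n div d) - j)"
        unfolding double_dvd_iff(2)[OF m n d True] by simp
      then obtain i' :: int where "pi * of_int (j + int (n div d)) / n = 2 * pi * of_int i' / m + \<tau>"
        using coaxial_half_turns[OF m n ji] by blast
      moreover have "odd (n div d)" by (rule double_dvd_iff(1)[OF m n d True])
      ultimately have "?c \<tau> = conj_class (D2_d d)"
        using c_even[OF ji] c_even[of "j + int (n div d)" i'] groups(2)[OF True] by (cases "even j") simp_all
      then show ?thesis using True by simp
    qed
    then have "range ?c \<subseteq> ?R" by (rule image_subsetI)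
    moreover have "conj_class (Z2_minus d) \<in> range ?c"
      by (rule range_eqI[where f = ?c, OF generic[unfolded groups(1)[OF True], symmetric]])
    moreover have "conj_class (D2_d d) \<in> range ?c"
      by (rule range_eqI[where f = ?c, OF zero[unfolded groups(2)[OF True], symmetric]])
    ultimately show ?thesis using True by (intro subset_antisym) simp_all
  next
    case False
    have "?c \<tau> \<in> ?R" for \<tau>
    proof (cases "\<exists>j i :: int. pi * of_int j / n = 2 * pi * of_int i / m + \<tau>")
      case none: False
      then show ?thesis using c_empty[of \<tau>] groups(3)[OF False] False by simp
    next
      case True
      then obtain j i :: int where ji: "pi * of_int j / n = 2 * pi * of_int i / m + \<tau>" by blast
      show ?thesis
        using c_even[OF ji] c_odd[OF ji] groups(4,5)[OF False] False by (cases "even j") simp_all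
    qed
    then have "range ?c \<subseteq> ?R" by (rule image_subsetI)
    moreover have "conj_class (Z_gp d) \<in> range ?c"
      by (rule range_eqI[where f = ?c, OF generic[unfolded groups(3)[OF False], symmetric]])
    moreover have "conj_class (D_gp d) \<in> range ?c"
      by (rule range_eqI[where f = ?c, OF zero[unfolded groups(4)[OF False], symmetric]])
    moreover have "conj_class (D_z d) \<in> range ?c"
      by (rule range_eqI[where f = ?c, OF one[unfolded groups(5)[OF False], symmetric]])
    ultimately show ?thesis using False by (intro subset_antisym) simp_all
  qed
qed

section \<open>Intersections with distinct axes\<close>

text \<open>The sign of an element is well defined because full turns change its index by an even number,
namely a multiple of \<open>2n\<close>.\<close>

lemma rot_mem_D2_d_iff:
  assumes n: "n \<ge> 1" and e: "e \<in> {1,-1}"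
  shows "e *\<^sub>R rot e3 (pi * of_int i / n) \<in> D2_d n \<longleftrightarrow> e = alt_sign i"
    and "e *\<^sub>R half_turn (pi * of_int i / n) \<in> D2_d n \<longleftrightarrow> e = alt_sign i"
proof -
  have *: "alt_sign i = alt_sign j"
      if "pi * of_int i / real n = pi * of_int j / real n + 2 * pi * of_int k" for j k :: int
  proof -
    have "pi * real_of_int i = pi * real_of_int (j + 2 * int n * k)"
      using that n by (simp add: field_simps)
    then have "real_of_int i = real_of_int (j + 2 * int n * k)" unfolding mult_left_cancel[OF pi_neq_zero] .
    then have "i = j + 2 * int n * k" by (simp only: of_int_eq_iff)
    then show ?thesis by (simp add: alt_sign_def)
  qed
  show "e *\<^sub>R rot e3 (pi * of_int i / n) \<in> D2_d n \<longleftrightarrow> e = alt_sign i"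
  proof
    assume "e *\<^sub>R rot e3 (pi * of_int i / n) \<in> D2_d n"
    then obtain j where "e = alt_sign j" "rot e3 (pi * of_int i / n) = rot e3 (pi * of_int j / n)"
      unfolding D2_d_eq[OF n] by (elim UnE rangeE) (simp_all only: signed_rot_half_turn_eq[OF e alt_sign(1)])
    then obtain k :: int where k: "pi * of_int i / n = pi * of_int j / n + 2 * pi * of_int k"
        unfolding rot_eq_iff by blast
    show "e = alt_sign i" using *[OF k] \<open>e = alt_sign j\<close> by simp
  next
    assume "e = alt_sign i" then show "e *\<^sub>R rot e3 (pi * of_int i / n) \<in> D2_d n"
      unfolding D2_d_eq[OF n] by blast
  qed
  show "e *\<^sub>R half_turn (pi * of_int i / n) \<in> D2_d n \<longleftrightarrow> e = alt_sign i"
  proof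
    assume "e *\<^sub>R half_turn (pi * of_int i / n) \<in> D2_d n"
    then obtain j where "e = alt_sign j" "half_turn (pi * of_int i / n) = half_turn (pi * of_int j / n)"
      unfolding D2_d_eq[OF n] by (elim UnE rangeE) (simp_all only: signed_rot_half_turn_eq[OF e alt_sign(1)])
    then obtain k :: int where k: "pi * of_int i / n = pi * of_int j / n + 2 * pi * of_int k"
        unfolding half_turn_eq_iff by blast
    show "e = alt_sign i" using *[OF k] \<open>e = alt_sign j\<close> by simp
  next
    assume "e = alt_sign i" then show "e *\<^sub>R half_turn (pi * of_int i / n) \<in> D2_d n"
      unfolding D2_d_eq[OF n] by blast
  qed
qed

lemma mat_1_mem:
  assumes n: "n \<ge> 1"
  shows "mat 1 \<in> D2_d n" "- mat 1 \<notin> D2_d n"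
proof -
  show "mat 1 \<in> D2_d n" using rot_mem_D2_d_iff(1)[OF n, of 1 0] by (simp add: rot_e3_0 alt_sign_def)
  show "- mat 1 \<notin> D2_d n" using rot_mem_D2_d_iff(1)[OF n, of "-1" 0] by (simp add: rot_e3_0 alt_sign_def)
qed

lemma mat_1_in_prism: "mat 1 \<in> prism m 0"
  using prismI(1)[of 1 0 m 0] by (simp add: rot_e3_0)

lemma mat_vec3:
  "(rot e3 t *v a) $ 1 = cos t * a $ 1 - sin t * a $ 2" "(rot e3 t *v a) $ 2 = sin t * a $ 1 + cos t * a $ 2"
  "(rot e3 t *v a) $ 3 = a $ 3"
  "(half_turn t *v a) $ 1 = cos t * a $ 1 + sin t * a $ 2"
      "(half_turn t *v a) $ 2 = sin t * a $ 1 - cos t * a $ 2"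
  "(half_turn t *v a) $ 3 = - a $ 3"
  by (simp_all add: rot_e3 half_turn_matrix matrix_vector_mult_def sum_3)

lemma e3_components: "(e3 :: real^3) $ 1 = 0" "(e3 :: real^3) $ 2 = 0" "(e3 :: real^3) $ 3 = 1"
  by (simp_all add: axis_def)

lemma scaleR_mult_vec: "(c *\<^sub>R A) *v x = c *\<^sub>R (A *v (x :: real^3))"
  by (simp add: vec_eq_iff matrix_vector_mult_def sum_3 forall_3 algebra_simps)

lemma prism_axis:
  assumes "x \<in> prism m \<tau>"
  obtains c where "c \<in> {1,-1::real}" "x *v e3 = c *\<^sub>R e3"
proof -
  have v: "rot e3 t *v e3 = e3" "half_turn t *v e3 = - e3" for t
    by (simp_all add: vec_eq_iff forall_3 mat_vec3 e3_components)
  show ?thesis using assms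
  proof (cases rule: prismE)
    case (1 a i) then show ?thesis using that[of a] by (simp add: scaleR_mult_vec v)
  next
    case (2 a i) then show ?thesis using that[of "- a"] by (auto simp add: scaleR_mult_vec v)
  qed
qed

lemma conj_prism_axis:
  assumes g: "g \<in> carrier O3" and x: "x \<in> conj_subgroup g (prism m 0)"
  obtains c where "c \<in> {1,-1::real}" "x *v (g *v e3) = c *\<^sub>R (g *v e3)"
proof -
  have gg: "g ** tr g = mat 1" using g by (auto simp: O3_def orthogonal_matrix_def)
  have "tr g ** x ** g \<in> prism m 0" using x by (simp add: mem_conj_subgroup_iff[OF g])
  then obtain c where c: "c \<in> {1,-1::real}" "(tr g ** x ** g) *v e3 = c *\<^sub>R e3" by (rule prism_axis)
  have "g *v ((tr g ** x ** g) *v e3) = ((g ** tr g) ** x) *v (g *v e3)"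
    by (simp add: matrix_vector_mul_assoc matrix_mul_assoc)
  then have "x *v (g *v e3) = g *v (c *\<^sub>R e3)" by (simp add: gg c(2))
  then show ?thesis using that[OF c(1)] by (simp add: matrix_vector_mult_scaleR)
qed

text \<open>In the horizontal plane, \<open>a\<close> has azimuth \<open>\<phi>\<close>, which a rotation by \<open>s\<close> increases by \<open>s\<close>; the result can
be parallel to \<open>a\<close> only if \<open>s\<close> is a multiple of \<open>\<pi>\<close>.\<close>

lemma rot_eigenvector:
  assumes a: "a $ 1 = \<rho> * cos \<phi>" "a $ 2 = \<rho> * sin \<phi>" "\<rho> \<noteq> 0" and ev: "rot e3 s *v a = c *\<^sub>R a"
  shows "cos s = c" "sin s = 0" "a $ 3 = c * a $ 3"
proof -
  have "(rot e3 s *v a) $ i = (c *\<^sub>R a) $ i" for i by (simp add: ev)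
  from this[of 1] this[of 2] this[of 3]
  have 1: "\<rho> * (cos s * cos \<phi> - sin s * sin \<phi>) = \<rho> * (c * cos \<phi>)"
      "\<rho> * (sin s * cos \<phi> + cos s * sin \<phi>) = \<rho> * (c * sin \<phi>)"
    and "a $ 3 = c * a $ 3"
    by (simp_all add: mat_vec3 a(1,2) algebra_simps)
  then show "a $ 3 = c * a $ 3" by simp
  have 2: "cos s * cos \<phi> - sin s * sin \<phi> = c * cos \<phi>" "sin s * cos \<phi> + cos s * sin \<phi> = c * sin \<phi>"
    using 1 a(3) by simp_all
  have 3: "(cos \<phi>)\<^sup>2 + (sin \<phi>)\<^sup>2 = 1" by simp
  show "cos s = c" using 2 3 by algebra
  show "sin s = 0" using 2 3 by algebra
qed

text \<open>In the horizontal plane \<open>half_turn s\<close> acts as the reflection that sends azimuth \<open>\<phi>\<close> to \<open>s - \<phi>\<close>, so \<open>s\<close>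
is determined by \<open>\<phi>\<close> and the eigenvalue.\<close>

lemma half_turn_eigenvector:
  assumes a: "a $ 1 = \<rho> * cos \<phi>" "a $ 2 = \<rho> * sin \<phi>" "\<rho> \<noteq> 0" and ev: "half_turn s *v a = c *\<^sub>R a"
  shows "cos s = c * cos (2 * \<phi>)" "sin s = c * sin (2 * \<phi>)" "- a $ 3 = c * a $ 3"
proof -
  have "(half_turn s *v a) $ i = (c *\<^sub>R a) $ i" for i by (simp add: ev)
  from this[of 1] this[of 2] this[of 3]
  have 1: "\<rho> * (cos s * cos \<phi> + sin s * sin \<phi>) = \<rho> * (c * cos \<phi>)"
      "\<rho> * (sin s * cos \<phi> - cos s * sin \<phi>) = \<rho> * (c * sin \<phi>)"
    and "- a $ 3 = c * a $ 3"
    by (simp_all add: mat_vec3 a(1,2) algebra_simps)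
  then show "- a $ 3 = c * a $ 3" by simp
  have 2: "cos s * cos \<phi> + sin s * sin \<phi> = c * cos \<phi>" "sin s * cos \<phi> - cos s * sin \<phi> = c * sin \<phi>"
    using 1 a(3) by simp_all
  have 3: "(cos \<phi>)\<^sup>2 + (sin \<phi>)\<^sup>2 = 1" by simp
  show "cos s = c * cos (2 * \<phi>)" using 2 3 unfolding cos_double by algebra
  show "sin s = c * sin (2 * \<phi>)" using 2 3 unfolding sin_double by algebra
qed

lemma signed_eigenvector:
  assumes "e \<in> {1,-1::real}" "(e *\<^sub>R A) *v w = c *\<^sub>R (w::real^3)"
  shows "A *v w = (e * c) *\<^sub>R w"
proof -
  have "e * e = 1" using assms(1) by auto
  moreover have "e *\<^sub>R (A *v w) = c *\<^sub>R w" using assms(2) unfolding scaleR_mult_vec .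
  then have "e *\<^sub>R (e *\<^sub>R (A *v w)) = e *\<^sub>R (c *\<^sub>R w)" by (simp only:)
  ultimately show ?thesis by (simp only: scaleR_scaleR scaleR_one)
qed

lemma polar_form:
  assumes "(a::real^3) $ 1 \<noteq> 0 \<or> a $ 2 \<noteq> 0"
  obtains \<rho> \<phi> where "\<rho> \<noteq> 0" "a $ 1 = \<rho> * cos \<phi>" "a $ 2 = \<rho> * sin \<phi>"
proof -
  define \<rho> where "\<rho> = sqrt ((a $ 1)\<^sup>2 + (a $ 2)\<^sup>2)"
  have pos: "(a $ 1)\<^sup>2 + (a $ 2)\<^sup>2 > 0" using assms by (auto simp: sum_power2_gt_zero_iff)
  then have \<rho>: "\<rho> \<noteq> 0" "\<rho>\<^sup>2 = (a $ 1)\<^sup>2 + (a $ 2)\<^sup>2" by (auto simp: \<rho>_def)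
  have "(a $ 1 / \<rho>)\<^sup>2 + (a $ 2 / \<rho>)\<^sup>2 = ((a $ 1)\<^sup>2 + (a $ 2)\<^sup>2) / \<rho>\<^sup>2"
    by (simp add: power_divide add_divide_distrib)
  also have "\<dots> = 1" unfolding \<rho>(2) using pos by (intro divide_self) linarith
  finally have "(a $ 1 / \<rho>)\<^sup>2 + (a $ 2 / \<rho>)\<^sup>2 = 1" .
  then obtain t where "a $ 1 / \<rho> = cos t" "a $ 2 / \<rho> = sin t" using sincos_total_2pi by metis
  then show ?thesis using that[of \<rho> t] \<rho>(1) by (simp add: field_simps)
qed

lemma trace_conj:
  assumes "g \<in> carrier O3"
  shows "trace (tr g ** x ** g) = trace x"
proof -
  have "g ** tr g = mat 1" using assms by (auto simp: O3_def orthogonal_matrix_def)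
  have "trace (tr g ** x ** g) = trace (g ** (tr g ** x))" by (rule trace_mul_sym)
  also have "g ** (tr g ** x) = (g ** tr g) ** x" by (rule matrix_mul_assoc)
  finally show ?thesis by (simp add: \<open>g ** tr g = mat 1\<close>)
qed

text \<open>After turning the azimuth of \<open>g e3\<close> to zero, all common elements are diagonal, since each has \<open>g e3\<close> as
an eigenvector. The opposite of the identity is excluded because \<open>D2_d n\<close> does not contain it.\<close>

lemma conj_subgroup_Int_axis:
  fixes m :: nat
  assumes n: "n \<ge> 1" and g: "g \<in> carrier O3"
    and a: "(g *v e3) $ 1 = \<rho> * cos \<phi>" "(g *v e3) $ 2 = \<rho> * sin \<phi>" "\<rho> \<noteq> 0"
  defines "S \<equiv> conj_subgroup (rot e3 (- \<phi>)) (D2_d n \<inter> conj_subgroup g (prism m 0))"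
  shows "S \<subseteq> diag_signs" "mult_closed S" "mat 1 \<in> S" "- mat 1 \<notin> S"
    "conj_class S = conj_class (D2_d n \<inter> conj_subgroup g (prism m 0))"
    "x \<in> S \<longleftrightarrow> rot e3 \<phi> ** x ** rot e3 (- \<phi>) \<in> D2_d n \<inter> conj_subgroup g (prism m 0)"
proof -
  let ?K = "D2_d n \<inter> conj_subgroup g (prism m 0)"
  have mem: "x \<in> S \<longleftrightarrow> rot e3 \<phi> ** x ** rot e3 (- \<phi>) \<in> ?K" for x
    unfolding S_def mem_conj_subgroup_iff[OF rot_half_turn_in_O3(1)] transpose_rot_half_turn by simp
  show "x \<in> S \<longleftrightarrow> rot e3 \<phi> ** x ** rot e3 (- \<phi>) \<in> ?K" by (rule mem)
  have one: "rot e3 \<phi> ** mat 1 ** rot e3 (- \<phi>) = mat 1" "rot e3 \<phi> ** (- mat 1) ** rot e3 (- \<phi>) = - mat 1"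
    by (simp_all add: neg_mult_matrix rot_half_turn_mult rot_e3_0)
  have tgg: "tr g ** mat 1 ** g = mat 1" using g by (auto simp: O3_def orthogonal_matrix_def)
  then have "mat 1 \<in> conj_subgroup g (prism m 0)"
    using mat_1_in_prism by (simp only: mem_conj_subgroup_iff[OF g])
  then show "mat 1 \<in> S" unfolding mem one using mat_1_mem[OF n] by blast
  show "- mat 1 \<notin> S" unfolding mem one using mat_1_mem[OF n] by blast
  show "mult_closed S"
    unfolding S_def
        by (intro mult_closed_conj mult_closed_Int mult_closed_D2_d mult_closed_prism rot_half_turn_in_O3 n g)
  show "conj_class S = conj_class ?K"
    unfolding S_def by (intro conj_class_conj_subgroup rot_half_turn_in_O3 le_infI1 D2_d_subset_O3 n)
  show "S \<subseteq> diag_signs"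
  proof
    fix y assume "y \<in> S"
    then obtain x where x: "x \<in> ?K" and y: "y = rot e3 (- \<phi>) ** x ** tr (rot e3 (- \<phi>))"
      unfolding S_def conj_subgroup_matrix[OF rot_half_turn_in_O3(1)] by blast
    from x have "x \<in> conj_subgroup g (prism m 0)" by blast
    then obtain c where c: "c \<in> {1,-1::real}" "x *v (g *v e3) = c *\<^sub>R (g *v e3)"
      by (rule conj_prism_axis[OF g])
    from x have "x \<in> D2_d n" by blast
    then obtain j :: int
        where "x = alt_sign j *\<^sub>R rot e3 (pi * j / n) \<or> x = alt_sign j *\<^sub>R half_turn (pi * j / n)"
      unfolding D2_d_eq[OF n] by blast
    then show "y \<in> diag_signs"
    proof
      assume xj: "x = alt_sign j *\<^sub>R rot e3 (pi * j / n)"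
      note e = rot_eigenvector[OF a signed_eigenvector[OF alt_sign(1) c(2)[unfolded xj]]]
      have "y = alt_sign j *\<^sub>R rot e3 (pi * j / n)"
        unfolding y xj by (simp add: scaleR_mult_matrix transpose_rot_half_turn rot_half_turn_mult)
      also have "\<dots> = diag3 c c (alt_sign j)"
        unfolding diag3_def rot_e3 e(1,2) using c(1) by (simp add: vec_eq_iff forall_3 alt_sign_def)
      finally show ?thesis using c(1) alt_sign(1) by blast
    next
      assume xj: "x = alt_sign j *\<^sub>R half_turn (pi * j / n)"
      note e = half_turn_eigenvector[OF a signed_eigenvector[OF alt_sign(1) c(2)[unfolded xj]]]
      have cs: "(cos (2 * \<phi>))\<^sup>2 + (sin (2 * \<phi>))\<^sup>2 = 1" by simp
      have y': "y = alt_sign j *\<^sub>R half_turn (pi * j / n - 2 * \<phi>)"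
        unfolding y xj by (simp add: scaleR_mult_matrix transpose_rot_half_turn rot_half_turn_mult)
      have "cos (pi * j / n - 2 * \<phi>) = alt_sign j * c"
        unfolding cos_diff e(1,2) using cs by algebra
      moreover have "sin (pi * j / n - 2 * \<phi>) = 0"
        unfolding sin_diff e(1,2) by simp
      ultimately have "y = diag3 c (- c) (- alt_sign j)"
        unfolding y' diag3_def half_turn_matrix using c(1) by (simp add: vec_eq_iff forall_3 alt_sign_def)
      moreover have "- c \<in> {1,-1}" "- alt_sign j \<in> {1,-1}" using c(1) alt_sign(1)[of j] by auto
      ultimately show ?thesis using c(1) by blast
    qed
  qed
qed

text \<open>The half-turn about \<open>e3\<close> has \<open>g e3\<close> as an eigenvector only if \<open>g e3\<close> is horizontal. The
half-turn about \<open>g e3\<close> is then common up to sign, so its conjugate by the inverse of \<open>g\<close> is, up to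
sign, an element of \<open>D_gp m\<close> fixing \<open>e3\<close>. The trace identifies it as the rotation by \<open>\<pi>\<close> about \<open>e3\<close>, which
belongs to \<open>D_gp m\<close> only for even \<open>m\<close>. The sign \<open>\<epsilon>\<close> is that of the index \<open>n\<close> in \<open>D2_d n\<close>.\<close>

lemma klein_intersection:
  assumes n: "n \<ge> 1" and m: "m \<ge> 1" and g: "g \<in> carrier O3"
    and a: "(g *v e3) $ 1 = \<rho> * cos \<phi>" "(g *v e3) $ 2 = \<rho> * sin \<phi>" "\<rho> \<noteq> 0"
    and ed: "\<epsilon> \<in> {1,-1}" "\<delta> \<in> {1,-1}"
    and K: "conj_subgroup (rot e3 (- \<phi>)) (D2_d n \<inter> conj_subgroup g (prism m 0)) = klein \<epsilon> \<delta>"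
  shows "even m" "\<epsilon> = alt_sign (int n)"
proof -
  note mem = conj_subgroup_Int_axis(6)[where m = m, OF n g a, unfolded K]
  have conj: "rot e3 \<phi> ** (\<epsilon> *\<^sub>R rot e3 pi) ** rot e3 (- \<phi>) = \<epsilon> *\<^sub>R rot e3 pi"
    "rot e3 \<phi> ** (\<delta> *\<^sub>R rot e1 pi) ** rot e3 (- \<phi>) = \<delta> *\<^sub>R half_turn (2 * \<phi>)"
    unfolding half_turn_0[symmetric] by (simp_all add: scaleR_mult_matrix rot_half_turn_mult)
  have R: "\<epsilon> *\<^sub>R rot e3 pi \<in> D2_d n" "\<epsilon> *\<^sub>R rot e3 pi \<in> conj_subgroup g (prism m 0)"
    using mem[of "\<epsilon> *\<^sub>R rot e3 pi"] unfolding conj klein_def by blast+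
  have F: "\<delta> *\<^sub>R half_turn (2 * \<phi>) \<in> conj_subgroup g (prism m 0)"
    using mem[of "\<delta> *\<^sub>R rot e1 pi"] unfolding conj klein_def by blast
  have "pi * real_of_int (int n) / real n = pi" using n by simp
  then show "\<epsilon> = alt_sign (int n)" using rot_mem_D2_d_iff(1)[OF n ed(1), of "int n"] R(1) by simp
  obtain c where c: "c \<in> {1,-1::real}" "(\<epsilon> *\<^sub>R rot e3 pi) *v (g *v e3) = c *\<^sub>R (g *v e3)"
    using conj_prism_axis[OF g R(2)] .
  note ev = rot_eigenvector[OF a signed_eigenvector[OF ed(1) c(2)]]
  then have a3: "(g *v e3) $ 3 = 0" by simp
  have cs: "(cos \<phi>)\<^sup>2 + (sin \<phi>)\<^sup>2 = 1" by simp
  have Fa: "half_turn (2 * \<phi>) *v (g *v e3) = g *v e3"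
  proof -
    have "cos (2*\<phi>) * cos \<phi> + sin (2*\<phi>) * sin \<phi> = cos \<phi>" "sin (2*\<phi>) * cos \<phi> - cos (2*\<phi>) * sin \<phi> = sin \<phi>"
      unfolding cos_diff[symmetric] sin_diff[symmetric] by simp_all
    then have "\<rho> * (cos (2*\<phi>) * cos \<phi> + sin (2*\<phi>) * sin \<phi>) = \<rho> * cos \<phi>"
        "\<rho> * (sin (2*\<phi>) * cos \<phi> - cos (2*\<phi>) * sin \<phi>) = \<rho> * sin \<phi>"
      by simp_all
    then show ?thesis by (simp add: vec_eq_iff forall_3 mat_vec3 a(1,2) a3 algebra_simps)
  qed
  define z where "z = tr g ** (\<delta> *\<^sub>R half_turn (2 * \<phi>)) ** g"
  have z: "z \<in> prism m 0" using F unfolding z_def mem_conj_subgroup_iff[OF g] .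
  have gg: "tr g ** g = mat 1" using g by (auto simp: O3_def orthogonal_matrix_def)
  have "z *v e3 = tr g *v (\<delta> *\<^sub>R (half_turn (2 * \<phi>) *v (g *v e3)))"
    unfolding z_def matrix_vector_mul_assoc[symmetric] by (simp add: scaleR_mult_vec)
  also have "\<dots> = \<delta> *\<^sub>R ((tr g ** g) *v e3)" unfolding Fa
      by (simp add: matrix_vector_mult_scaleR matrix_vector_mul_assoc)
  finally have z3: "z *v e3 = \<delta> *\<^sub>R e3" by (simp add: gg)
  have trz: "trace z = - \<delta>"
    unfolding z_def trace_conj[OF g] by (simp add: trace_def sum_3 half_turn_matrix)
  \<comment> \<open>Comparing the action on \<open>e3\<close> with the trace excludes the horizontal half-turns.\<close>
  from z show "even m"
  proof (cases rule: prismE)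
    case (1 b i)
    have "(z *v e3) $ 3 = b" unfolding 1(2) by (simp add: scaleR_mult_vec mat_vec3 e3_components)
    then have "b = \<delta>" unfolding z3 by (simp add: e3_components)
    moreover have "trace z = b * (2 * cos (2 * pi * i / m) + 1)" unfolding 1(2)
        by (simp add: trace_def sum_3 rot_e3 algebra_simps)
    ultimately have "cos (2 * pi * i / m) = - 1" using trz ed(2) by auto
    then obtain k :: int where "2 * pi * i / m = of_int (2 * k + 1) * pi"
      unfolding cos_eq_minus1 by (auto simp: algebra_simps)
    then have "pi * real_of_int (2 * i) = pi * real_of_int ((2 * k + 1) * int m)"
      using m by (simp add: field_simps)
    then have "real_of_int (2 * i) = real_of_int ((2 * k + 1) * int m)"
        unfolding mult_left_cancel[OF pi_neq_zero] .
    then have "2 * i = (2 * k + 1) * int m" by (simp only: of_int_eq_iff)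
    from arg_cong[OF this, of even] show ?thesis by simp
  next
    case (2 b i)
    have "(z *v e3) $ 3 = - b" unfolding 2(2) by (simp add: scaleR_mult_vec mat_vec3 e3_components)
    moreover have "trace z = - b" unfolding 2(2) by (simp add: trace_def sum_3 half_turn_matrix)
    ultimately show ?thesis using trz z3 ed(2) by (auto simp: e3_components)
  qed
qed

lemma tilted_intersection_class:
  assumes n: "n \<ge> 1" and m: "m \<ge> 1" and g: "g \<in> carrier O3"
    and a: "(g *v e3) $ 1 \<noteq> 0 \<or> (g *v e3) $ 2 \<noteq> 0"
  shows "conj_class (D2_d n \<inter> conj_subgroup g (prism m 0)) \<in>
    {conj_class trivial_gp, conj_class (Z_gp 2), conj_class (Z2_minus 1)} \<union>
    (if odd m then {} else if odd n then {conj_class (D_z 2)} else {conj_class (D_gp 2), conj_class (D_z 2)})"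
proof -
  obtain \<rho> \<phi> where rf: "(g *v e3) $ 1 = \<rho> * cos \<phi>" "(g *v e3) $ 2 = \<rho> * sin \<phi>" "\<rho> \<noteq> 0"
    using polar_form[OF a] by blast
  note S = conj_subgroup_Int_axis[where m = m, OF n g rf]
  show ?thesis using diag_signs_subgroup_cases[OF S(1-4)]
  proof
    assume "conj_class (conj_subgroup (rot e3 (- \<phi>)) (D2_d n \<inter> conj_subgroup g (prism m 0))) \<in>
      {conj_class trivial_gp, conj_class (Z_gp 2), conj_class (Z2_minus 1)}"
    then show ?thesis unfolding S(5) by (rule UnI1)
  next
    assume "\<exists>\<epsilon> \<delta>. \<epsilon> \<in> {1,-1} \<and> \<delta> \<in> {1,-1} \<and>
       conj_subgroup (rot e3 (- \<phi>)) (D2_d n \<inter> conj_subgroup g (prism m 0)) = klein \<epsilon> \<delta>"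
    then obtain \<epsilon> \<delta> where ed: "\<epsilon> \<in> {1,-1}" "\<delta> \<in> {1,-1}"
      and K: "conj_subgroup (rot e3 (- \<phi>)) (D2_d n \<inter> conj_subgroup g (prism m 0)) = klein \<epsilon> \<delta>" by blast
    note k = klein_intersection[OF n m g rf ed K]
    show ?thesis
      unfolding S(5)[symmetric] K conj_class_klein[OF ed] using k by (simp add: alt_sign_def)
  qed
qed

text \<open>Membership in a conjugate, phrased as an intertwining relation so that it can be checked without
computing inverses.\<close>

lemma conj_subgroup_prism_memI:
  assumes g: "g \<in> carrier O3" and A: "A ** g = g ** B" and B: "e *\<^sub>R B \<in> prism m 0"
  shows "e *\<^sub>R A \<in> conj_subgroup g (prism m 0)"
proof -
  have gg: "tr g ** g = mat 1" using g by (auto simp: O3_def orthogonal_matrix_def)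
  have "tr g ** A ** g = (tr g ** g) ** B" unfolding matrix_mul_assoc[symmetric] A ..
  then show ?thesis using B unfolding mem_conj_subgroup_iff[OF g] by (simp add: scaleR_mult_matrix gg)
qed

text \<open>The tilt by \<open>\<pi>/4\<close> about \<open>e1\<close> makes \<open>g e3\<close> neither vertical nor horizontal. A common element
other than the identity can then only be, up to sign, the half-turn about the horizontal line orthogonal to \<open>g e3\<close>, which is the axis of
\<open>half_turn (2 * \<phi>)\<close>. The tilt commutes with the half-turn about \<open>e1\<close>, so this half-turn does belong to
the conjugate.\<close>

lemma tilted_intersection:
  assumes n: "n \<ge> 1"
  defines "g \<phi> \<equiv> rot e3 \<phi> ** rot e1 (pi / 4)"
  shows "g \<phi> \<in> carrier O3" "(g \<phi> *v e3) $ 1 \<noteq> 0 \<or> (g \<phi> *v e3) $ 2 \<noteq> 0"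
    and "D2_d n \<inter> conj_subgroup (g \<phi>) (prism m 0) =
       insert (mat 1) {e *\<^sub>R half_turn (2 * \<phi>) | e. e \<in> {1,-1} \<and> e *\<^sub>R half_turn (2 * \<phi>) \<in> D2_d n}"
proof -
  have "rot e1 (pi / 4) \<in> carrier O3"
    by (simp add: O3_def orthogonal_matrix mat3 power2_eq_square[symmetric])
  then show g: "g \<phi> \<in> carrier O3"
    using O3.m_closed[OF rot_half_turn_in_O3(1)[of \<phi>]] unfolding g_def mult_O3 by blast
  let ?s = "sqrt 2 / 2 :: real"
  have a: "(g \<phi> *v e3) $ 1 = ?s * cos (\<phi> - pi / 2)" "(g \<phi> *v e3) $ 2 = ?s * sin (\<phi> - pi / 2)"
      "(g \<phi> *v e3) $ 3 = ?s"
  proof -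
    have "(rot e1 (pi / 4) *v e3) $ 1 = 0" "(rot e1 (pi / 4) *v e3) $ 2 = - ?s"
        "(rot e1 (pi / 4) *v e3) $ 3 = ?s"
      by (simp_all add: rot_e1 matrix_vector_mult_def sum_3 e3_components sin_45 cos_45)
    then show "(g \<phi> *v e3) $ 1 = ?s * cos (\<phi> - pi / 2)" "(g \<phi> *v e3) $ 2 = ?s * sin (\<phi> - pi / 2)"
        "(g \<phi> *v e3) $ 3 = ?s"
      unfolding g_def matrix_vector_mul_assoc[symmetric] by (simp_all add: mat_vec3 cos_diff sin_diff)
  qed
  have s0: "?s \<noteq> 0" by simp
  show "(g \<phi> *v e3) $ 1 \<noteq> 0 \<or> (g \<phi> *v e3) $ 2 \<noteq> 0"
    unfolding a using s0 sin_zero_abs_cos_one[of "\<phi> - pi / 2"] by auto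
  show "D2_d n \<inter> conj_subgroup (g \<phi>) (prism m 0) =
       insert (mat 1) {e *\<^sub>R half_turn (2 * \<phi>) | e. e \<in> {1,-1} \<and> e *\<^sub>R half_turn (2 * \<phi>) \<in> D2_d n}" (is "?K = ?R")
  proof
    show "?K \<subseteq> ?R"
    proof
      fix x assume x: "x \<in> ?K"
      then have "x \<in> conj_subgroup (g \<phi>) (prism m 0)" by blast
      then obtain c where c: "c \<in> {1,-1::real}" "x *v (g \<phi> *v e3) = c *\<^sub>R (g \<phi> *v e3)"
        by (rule conj_prism_axis[OF g])
      from x have xD: "x \<in> D2_d n" by blast
      then obtain j :: int
          where "x = alt_sign j *\<^sub>R rot e3 (pi * j / n) \<or> x = alt_sign j *\<^sub>R half_turn (pi * j / n)"
        unfolding D2_d_eq[OF n] by blast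
      then show "x \<in> ?R"
      proof
        assume xj: "x = alt_sign j *\<^sub>R rot e3 (pi * j / n)"
        note e = rot_eigenvector[OF a(1,2) s0 signed_eigenvector[OF alt_sign(1) c(2)[unfolded xj]]]
        have "alt_sign j * c = 1" using e(3) unfolding a(3) by simp
        then have "rot e3 (pi * j / n) = mat 1" using e(1,2) by (simp add: mat3)
        then have "x = mat 1 \<or> x = - mat 1" unfolding xj by (simp add: alt_sign_def)
        then show ?thesis using xD mat_1_mem(2)[OF n] by blast
      next
        assume xj: "x = alt_sign j *\<^sub>R half_turn (pi * j / n)"
        note e = half_turn_eigenvector[OF a(1,2) s0 signed_eigenvector[OF alt_sign(1) c(2)[unfolded xj]]]
        have "(alt_sign j * c) * ?s = (- 1) * ?s" using e(3) unfolding a(3) by simp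
        then have sc: "alt_sign j * c = - 1" unfolding mult_right_cancel[OF s0] .
        have "2 * (\<phi> - pi / 2) = 2 * \<phi> - pi" by simp
        then have "half_turn (pi * j / n) = half_turn (2 * \<phi>)" using e(1,2) unfolding sc
            by (simp add: half_turn_matrix cos_diff sin_diff)
        then have "x = alt_sign j *\<^sub>R half_turn (2 * \<phi>)" unfolding xj by simp
        then show ?thesis using xD alt_sign(1) by blast
      qed
    qed
    have "e *\<^sub>R half_turn (2 * \<phi>) \<in> conj_subgroup (g \<phi>) (prism m 0)" if e: "e \<in> {1,-1}" for e
    proof (rule conj_subgroup_prism_memI[OF g])
      have comm: "rot e1 (pi / 4) ** half_turn 0 = half_turn 0 ** rot e1 (pi / 4)" by (simp add: mat3)
      have "half_turn (2 * \<phi>) ** g \<phi> = (half_turn (2 * \<phi>) ** rot e3 \<phi>) ** rot e1 (pi / 4)" unfolding g_def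
          by (rule matrix_mul_assoc)
      also have "\<dots> = (rot e3 \<phi> ** half_turn 0) ** rot e1 (pi / 4)" by (simp add: rot_half_turn_mult)
      also have "\<dots> = g \<phi> ** half_turn 0" unfolding g_def matrix_mul_assoc[symmetric] comm ..
      finally show "half_turn (2 * \<phi>) ** g \<phi> = g \<phi> ** half_turn 0" .
      show "e *\<^sub>R half_turn 0 \<in> prism m 0" using prismI(2)[OF e, of 0 m 0] by simp
    qed
    moreover have "mat 1 \<in> conj_subgroup (g \<phi>) (prism m 0)"
      using conj_subgroup_prism_memI[OF g, of "mat 1" "mat 1" 1 m] mat_1_in_prism by simp
    ultimately show "?R \<subseteq> ?K" using mat_1_mem(1)[OF n] by blast
  qed
qed

text \<open>The azimuth \<open>\<phi>\<close> decides whether the single candidate \<open>half_turn (2 * \<phi>)\<close> lies in \<open>D2_d n\<close>, and with which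
sign: it does with sign plus for \<open>\<phi> = 0\<close>, with sign minus for \<open>\<phi> = \<pi>/(2n)\<close>, and with neither sign
half-way between.\<close>

lemma tilted_witnesses:
  assumes n: "n \<ge> 1" and C: "C \<in> {conj_class trivial_gp, conj_class (Z_gp 2), conj_class (Z2_minus 1)}"
  obtains g where "g \<in> carrier O3" "(g *v e3) $ 1 \<noteq> 0 \<or> (g *v e3) $ 2 \<noteq> 0"
    "conj_class (D2_d n \<inter> conj_subgroup g (prism m 0)) = C"
proof -
  let ?g = "\<lambda>\<phi>. rot e3 \<phi> ** rot e1 (pi / 4)"
  note K = tilted_intersection(3)[OF n, of _ m]
  note found = that[OF tilted_intersection(1,2)[OF n]]
  have K_half_turn: "D2_d n \<inter> conj_subgroup (?g \<phi>) (prism m 0)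
      = {mat 1, alt_sign i *\<^sub>R half_turn (pi * of_int i / n)}"
    if "2 * \<phi> = pi * of_int i / n" for \<phi> and i :: int
  proof -
    have "(e \<in> {1,-1} \<and> e *\<^sub>R half_turn (pi * of_int i / n) \<in> D2_d n) = (e = alt_sign i)" for e
    proof
      assume e: "e \<in> {1,-1} \<and> e *\<^sub>R half_turn (pi * of_int i / n) \<in> D2_d n"
      show "e = alt_sign i" using e unfolding rot_mem_D2_d_iff(2)[OF n conjunct1[OF e]] by (rule conjunct2)
    next
      assume e: "e = alt_sign i"
      show "e \<in> {1,-1} \<and> e *\<^sub>R half_turn (pi * of_int i / n) \<in> D2_d n"
        using rot_mem_D2_d_iff(2)[OF n alt_sign(1)[of i], of i] alt_sign(1)[of i] unfolding e by simp
    qed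
    then have "{e *\<^sub>R half_turn (2 * \<phi>) | e. e \<in> {1,-1} \<and> e *\<^sub>R half_turn (2 * \<phi>) \<in> D2_d n}
        = {alt_sign i *\<^sub>R half_turn (pi * of_int i / n)}"
      unfolding that by simp
    then show ?thesis unfolding K by simp
  qed
  from C consider "C = conj_class trivial_gp" | "C = conj_class (Z_gp 2)" | "C = conj_class (Z2_minus 1)"
      by blast
  then show ?thesis
  proof cases
    case 1
    have "e *\<^sub>R half_turn (2 * (pi / (4 * n))) \<notin> D2_d n" if e: "e \<in> {1,-1}" for e
    proof
      assume "e *\<^sub>R half_turn (2 * (pi / (4 * n))) \<in> D2_d n"
      then obtain j :: int where "half_turn (2 * (pi / (4 * n))) = half_turn (pi * j / n)"
        unfolding D2_d_eq[OF n]
            by (elim UnE rangeE) (simp_all only: signed_rot_half_turn_eq[OF e alt_sign(1)])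
      then obtain k :: int where "2 * (pi / (4 * n)) = pi * j / n + 2 * pi * k" unfolding half_turn_eq_iff
          by blast
      then have "pi * real_of_int 1 = pi * real_of_int (2 * j + 4 * int n * k)" using n
          by (simp add: field_simps)
      then have "real_of_int 1 = real_of_int (2 * j + 4 * int n * k)"
          unfolding mult_left_cancel[OF pi_neq_zero] .
      then have "1 = 2 * j + 4 * int n * k" by (simp only: of_int_eq_iff)
      from arg_cong[OF this, of even] show False by simp
    qed
    then have E: "{e *\<^sub>R half_turn (2 * (pi / (4 * n))) | e. e \<in> {1,-1}
        \<and> e *\<^sub>R half_turn (2 * (pi / (4 * n))) \<in> D2_d n} = {}" by blast
    show ?thesis by (rule found[of "pi / (4 * n)"]) (simp only: K E 1 trivial_gp_def)
  next
    case 2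
    have "{mat 1, alt_sign 0 *\<^sub>R half_turn (pi * of_int 0 / n)} = D_gp 1"
      unfolding D_gp_1 by (simp add: alt_sign_def half_turn_0)
    then show ?thesis using found[of 0] K_half_turn[of 0 0] unfolding 2 conj_class_D_gp_1[symmetric] by simp
  next
    case 3
    have g: "rot e3 (pi / (2 * n)) \<in> carrier O3" by (rule rot_half_turn_in_O3)
    have "D_z 1 = {mat 1, - rot e1 pi}"
      unfolding D_z_def Z_gp_1 trivial_gp_def l_coset_O3 by (simp add: insert_commute)
    then have "conj_subgroup (rot e3 (pi / (2 * n))) (D_z 1)
        = {mat 1, alt_sign 1 *\<^sub>R half_turn (pi * of_int 1 / n)}"
      unfolding conj_subgroup_matrix[OF g]
      by (simp add: half_turn_0[symmetric] neg_mult_matrix scaleR_mult_matrix transpose_rot_half_turn rot_half_turn_mult rot_e3_0 alt_sign_def)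
    moreover have "D_z 1 \<subseteq> carrier O3"
      unfolding D_z_eq[OF order_refl]
          using rot_half_turn_in_O3 scaleR_in_O3[OF rot_half_turn_in_O3(2), of "-1"] by auto
    ultimately have "conj_class {mat 1, alt_sign 1 *\<^sub>R half_turn (pi * of_int 1 / n)} = conj_class (D_z 1)"
      using conj_class_conj_subgroup[OF g, of "D_z 1"] by simp
    then show ?thesis using found[of "pi / (2 * n)"] K_half_turn[of "pi / (2 * n)" 1]
        unfolding 3 conj_class_D_z_1[symmetric] by simp
  qed
qed

text \<open>Here \<open>g e3\<close> is horizontal along the \<open>i\<close>-th half-turn axis of \<open>D2_d n\<close>. For even \<open>m\<close>, the prism contains
the half-turns about all coordinate axes. The swap \<open>P\<close> of \<open>e1\<close> and \<open>e3\<close> only permutes them, so the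
conjugate contains the half-turns about \<open>e3\<close> and about the \<open>i\<close>-th axis, whose signs in \<open>D2_d n\<close> are those
of \<open>n\<close> and \<open>i\<close>.\<close>

lemma perpendicular_witness:
  assumes n: "n \<ge> 1" and m: "even m" "m \<ge> 1"
  obtains g where "g \<in> carrier O3" "(g *v e3) $ 1 \<noteq> 0 \<or> (g *v e3) $ 2 \<noteq> 0"
    "conj_class (D2_d n \<inter> conj_subgroup g (prism m 0)) = conj_class (klein (alt_sign (int n)) (alt_sign i))"
proof -
  define P :: "real^3^3" where "P = vector [vector [0, 0, 1], vector [0, 1, 0], vector [1, 0, 0]]"
  define \<phi> where "\<phi> = pi * of_int i / (2 * n)"
  define g where "g = rot e3 \<phi> ** P"
  have P: "P \<in> carrier O3"
    by (simp add: P_def O3_def orthogonal_matrix mat3)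
  have g: "g \<in> carrier O3"
    using O3.m_closed[OF rot_half_turn_in_O3(1)[of \<phi>] P] unfolding g_def mult_O3 .
  have a: "(g *v e3) $ 1 = 1 * cos \<phi>" "(g *v e3) $ 2 = 1 * sin \<phi>" "(1::real) \<noteq> 0"
  proof -
    have "(P *v e3) $ 1 = 1" "(P *v e3) $ 2 = 0" "(P *v e3) $ 3 = 0"
      by (simp_all add: P_def matrix_vector_mult_def sum_3 e3_components)
    then show "(g *v e3) $ 1 = 1 * cos \<phi>" "(g *v e3) $ 2 = 1 * sin \<phi>"
      unfolding g_def matrix_vector_mul_assoc[symmetric] by (simp_all add: mat_vec3)
  qed simp
  note S = conj_subgroup_Int_axis[where m = m, OF n g a]
  have swap: "rot e3 pi ** P = P ** half_turn 0" "half_turn 0 ** P = P ** rot e3 pi"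
      by (simp_all add: P_def mat3)
  have gR: "rot e3 pi ** g = g ** half_turn 0"
  proof -
    have "rot e3 pi ** g = (rot e3 pi ** rot e3 \<phi>) ** P" unfolding g_def by (rule matrix_mul_assoc)
    also have "\<dots> = (rot e3 \<phi> ** rot e3 pi) ** P" by (simp add: rot_half_turn_mult add_ac)
    also have "\<dots> = g ** half_turn 0" unfolding g_def matrix_mul_assoc[symmetric] swap ..
    finally show ?thesis .
  qed
  have gF: "half_turn (2 * \<phi>) ** g = g ** rot e3 pi"
  proof -
    have "half_turn (2 * \<phi>) ** g = (half_turn (2 * \<phi>) ** rot e3 \<phi>) ** P" unfolding g_def
        by (rule matrix_mul_assoc)
    also have "\<dots> = (rot e3 \<phi> ** half_turn 0) ** P" by (simp add: rot_half_turn_mult)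
    also have "\<dots> = g ** rot e3 pi" unfolding g_def matrix_mul_assoc[symmetric] swap ..
    finally show ?thesis .
  qed
  obtain h where h: "m = 2 * h" using m(1) by (rule evenE)
  \<comment> \<open>For even \<open>m\<close> the prism contains the vertical half-turn.\<close>
  have half: "2 * pi * of_int (int h) / m = pi" using m(2) unfolding h by simp
  have "alt_sign (int n) *\<^sub>R rot e3 pi \<in> conj_subgroup g (prism m 0)"
    using prismI(2)[OF alt_sign(1)[of "int n"], of 0 m 0] by (intro conj_subgroup_prism_memI[OF g gR]) simp
  moreover have "alt_sign (int n) *\<^sub>R rot e3 pi \<in> D2_d n"
    using rot_mem_D2_d_iff(1)[OF n alt_sign(1)[of "int n"], of "int n"] n by simp
  moreover have "rot e3 \<phi> ** (alt_sign (int n) *\<^sub>R rot e3 pi) ** rot e3 (- \<phi>)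
      = alt_sign (int n) *\<^sub>R rot e3 pi"
    by (simp add: scaleR_mult_matrix rot_half_turn_mult)
  ultimately have 1: "alt_sign (int n) *\<^sub>R rot e3 pi \<in> conj_subgroup (rot e3 (- \<phi>)) (D2_d n \<inter> conj_subgroup g (prism m 0))"
    unfolding S(6) by simp
  have "alt_sign i *\<^sub>R half_turn (2 * \<phi>) \<in> conj_subgroup g (prism m 0)"
    using prismI(1)[OF alt_sign(1)[of i], of "int h" m 0] unfolding half
        by (rule conj_subgroup_prism_memI[OF g gF])
  moreover have "alt_sign i *\<^sub>R half_turn (2 * \<phi>) \<in> D2_d n"
    using rot_mem_D2_d_iff(2)[OF n alt_sign(1)[of i], of i] by (simp add: \<phi>_def)
  moreover have "rot e3 \<phi> ** (alt_sign i *\<^sub>R rot e1 pi) ** rot e3 (- \<phi>) = alt_sign i *\<^sub>R half_turn (2 * \<phi>)"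
    by (simp add: half_turn_0[symmetric] scaleR_mult_matrix rot_half_turn_mult)
  ultimately have 2: "alt_sign i *\<^sub>R rot e1 pi \<in> conj_subgroup (rot e3 (- \<phi>)) (D2_d n \<inter> conj_subgroup g (prism m 0))"
    unfolding S(6) by simp
  have "conj_subgroup (rot e3 (- \<phi>)) (D2_d n \<inter> conj_subgroup g (prism m 0))
      = klein (alt_sign (int n)) (alt_sign i)"
    by (rule klein_if_two_axes[OF S(1-4) alt_sign(1) alt_sign(1) 1 2])
  then have "conj_class (D2_d n \<inter> conj_subgroup g (prism m 0))
      = conj_class (klein (alt_sign (int n)) (alt_sign i))"
    using S(5) by simp
  moreover have "(g *v e3) $ 1 \<noteq> 0 \<or> (g *v e3) $ 2 \<noteq> 0"
    unfolding a using sin_zero_abs_cos_one[of \<phi>] by auto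
  ultimately show ?thesis using that[OF g] by blast
qed

lemma tilted_classes:
  assumes n: "n \<ge> 1" and m: "m \<ge> 1"
  shows "{conj_class (D2_d n \<inter> conj_subgroup g (prism m 0)) | g.
      g \<in> carrier O3 \<and> ((g *v e3) $ 1 \<noteq> 0 \<or> (g *v e3) $ 2 \<noteq> 0)} =
    {conj_class trivial_gp, conj_class (Z_gp 2), conj_class (Z2_minus 1)} \<union>
    (if odd m then {} else if odd n then {conj_class (D_z 2)} else {conj_class (D_gp 2), conj_class (D_z 2)})"
    (is "?T = ?B \<union> ?K")
proof
  show "?T \<subseteq> ?B \<union> ?K"
  proof
    fix C assume "C \<in> ?T"
    then obtain g where g: "g \<in> carrier O3" "(g *v e3) $ 1 \<noteq> 0 \<or> (g *v e3) $ 2 \<noteq> 0"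
      and C: "C = conj_class (D2_d n \<inter> conj_subgroup g (prism m 0))" by (elim CollectE exE conjE)
    show "C \<in> ?B \<union> ?K" unfolding C by (rule tilted_intersection_class[OF n m g])
  qed
  have "?B \<subseteq> ?T"
  proof
    fix C assume "C \<in> ?B"
    then obtain g where "g \<in> carrier O3" "(g *v e3) $ 1 \<noteq> 0 \<or> (g *v e3) $ 2 \<noteq> 0"
      "conj_class (D2_d n \<inter> conj_subgroup g (prism m 0)) = C" by (rule tilted_witnesses[OF n])
    then show "C \<in> ?T" by (intro CollectI exI[of _ g] conjI) simp_all
  qed
  moreover have "?K \<subseteq> ?T"
  proof (cases "even m")
    case True
    have w: "conj_class (klein (alt_sign (int n)) (alt_sign i)) \<in> ?T" for i
    proof -
      obtain g where "g \<in> carrier O3" "(g *v e3) $ 1 \<noteq> 0 \<or> (g *v e3) $ 2 \<noteq> 0"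
        "conj_class (D2_d n \<inter> conj_subgroup g (prism m 0))
            = conj_class (klein (alt_sign (int n)) (alt_sign i))"
        by (rule perpendicular_witness[OF n True m])
      then show ?thesis by (intro CollectI exI[of _ g] conjI) simp_all
    qed
    have "conj_class (klein (alt_sign (int n)) (alt_sign i)) = conj_class (if even n
        \<and> even i then D_gp 2 else D_z 2)" for i
      unfolding conj_class_klein[OF alt_sign(1) alt_sign(1)] by (simp add: alt_sign_def)
    then have "conj_class (if even n \<and> even i then D_gp 2 else D_z 2) \<in> ?T" for i :: int
      using w[of i] by (simp only:)
    from this[of 0] this[of 1] show ?thesis
      using True by (cases "even n") (simp_all only: even_zero odd_one if_True if_False simp_thms insert_subset empty_subsetI)
  qed simp
  ultimately show "?B \<union> ?K \<subseteq> ?T" by (rule Un_least)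
qed

section \<open>The clips\<close>

theorem lemma4p14:
  fixes m n d d\<^sub>2 :: nat
  assumes "m \<ge> 2" and "n \<ge> 2" and "d = gcd m n" and "d\<^sub>2 = gcd 2 n"
  shows "conj_class (D2_d n) \<circledcirc> conj_class (plus_Z2c (D_gp m)) =
    (if even (m div d) then
       {conj_class trivial_gp, conj_class (Z_gp 2), conj_class (D_gp d\<^sub>2), conj_class (Z2_minus 1),
        conj_class (Z2_minus d), conj_class (D_z 2), conj_class (D2_d d)}
     else if even m then
       {conj_class trivial_gp, conj_class (Z_gp 2), conj_class (D_gp 2), conj_class (Z2_minus 1),
        conj_class (D_z 2), conj_class (Z_gp d), conj_class (D_gp d), conj_class (D_z d)}
     else
       {conj_class trivial_gp, conj_class (Z_gp 2), conj_class (Z2_minus 1),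
        conj_class (Z_gp d), conj_class (D_gp d), conj_class (D_z d)})"
proof -
  have m: "m \<ge> 1" and n: "n \<ge> 1" using assms(1,2) by simp_all
  let ?tilted = "\<lambda>g. (g *v e3) $ 1 \<noteq> 0 \<or> (g *v e3) $ 2 \<noteq> (0::real)"
  let ?c = "\<lambda>g. conj_class (D2_d n \<inter> conj_subgroup g (prism m 0))"
  have coaxial: "{?c g | g. g \<in> carrier O3 \<and> \<not> ?tilted g} = range (\<lambda>\<tau>. conj_class (D2_d n \<inter> prism m \<tau>))"
  proof (intro subset_antisym subsetI)
    fix C assume "C \<in> {?c g | g. g \<in> carrier O3 \<and> \<not> ?tilted g}"
    then obtain g where g: "C = ?c g" "orthogonal_matrix g" "(g *v e3) $ 1 = 0" "(g *v e3) $ 2 = 0"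
      by (auto simp: O3_def)
    obtain e t where "e \<in> {1,-1::real}" "g = e *\<^sub>R rot e3 t \<or> g = e *\<^sub>R half_turn t"
      using orthogonal_preserving_axis[OF g(2-4)] .
    from conj_prism_coaxial[OF this, of m] show "C \<in> range (\<lambda>\<tau>. conj_class (D2_d n \<inter> prism m \<tau>))"
      unfolding g(1) by simp
  next
    fix C assume "C \<in> range (\<lambda>\<tau>. conj_class (D2_d n \<inter> prism m \<tau>))"
    then obtain \<tau> where C: "C = conj_class (D2_d n \<inter> prism m \<tau>)" by blast
    have "conj_subgroup (rot e3 (\<tau> / 2)) (prism m 0) = prism m \<tau>"
      using conj_prism_coaxial[of 1 "rot e3 (\<tau> / 2)" "\<tau> / 2" m] by simp
    then have "C = ?c (rot e3 (\<tau> / 2))" unfolding C by simp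
    moreover have "\<not> ?tilted (rot e3 (\<tau> / 2))" by (simp add: mat_vec3 e3_components)
    ultimately show "C \<in> {?c g | g. g \<in> carrier O3 \<and> \<not> ?tilted g}"
      using rot_half_turn_in_O3(1) by (intro CollectI exI[of _ "rot e3 (\<tau> / 2)"] conjI)
  qed
  have "conj_class (D2_d n) \<circledcirc> conj_class (plus_Z2c (D_gp m)) = {?c g | g. g \<in> carrier O3}"
    unfolding plus_Z2c_D_gp[OF m] by (rule clips_conj_class[OF D2_d_subset_O3[OF n] prism_subset_O3])
  also have "\<dots> = {?c g | g. g \<in> carrier O3 \<and> ?tilted g} \<union> {?c g | g. g \<in> carrier O3 \<and> \<not> ?tilted g}"
  proof -
    have "{f g | g. P g} = {f g | g. P g \<and> Q g} \<union> {f g | g. P g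
        \<and> \<not> Q g}" for f :: "real^3^3 \<Rightarrow> (real^3^3) set set" and P Q
      by blast
    then show ?thesis .
  qed
  finally have clips: "conj_class (D2_d n) \<circledcirc> conj_class (plus_Z2c (D_gp m)) =
     {conj_class trivial_gp, conj_class (Z_gp 2), conj_class (Z2_minus 1)} \<union>
     (if odd m then {} else
         if odd n then {conj_class (D_z 2)} else {conj_class (D_gp 2), conj_class (D_z 2)}) \<union>
     (if even (m div d) then {conj_class (Z2_minus d), conj_class (D2_d d)}
      else {conj_class (Z_gp d), conj_class (D_gp d), conj_class (D_z d)})"
    unfolding coaxial tilted_classes[OF n m] coaxial_classes[OF m n assms(3)] .
  have md: "m = d * (m div d)" and dn: "d dvd n" using assms(3) by simp_all
  show ?thesis
  proof (cases "even (m div d)")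
    case True
    then have "even m" using md by (metis dvd_mult)
    \<comment> \<open>\<open>D_gp d\<^sub>2\<close> encodes the parity of \<open>n\<close>: for odd \<open>n\<close> it repeats the class of \<open>Z_gp 2\<close>.\<close>
    have "conj_class (D_gp d\<^sub>2) = (if odd n then conj_class (Z_gp 2) else conj_class (D_gp 2))"
    proof (cases "even n")
      case True
      then have "d\<^sub>2 = 2" using assms(4) by (simp add: gcd_nat.absorb1)
      then show ?thesis using True by simp
    next
      case False
      then have "d\<^sub>2 = 1" using assms(4) by (metis coprime_iff_gcd_eq_1 coprime_left_2_iff_odd)
      then show ?thesis using False conj_class_D_gp_1 by simp
    qed
    then show ?thesis unfolding clips using True \<open>even m\<close> by (simp add: insert_commute)
  next
    case odd: False
    show ?thesis
    proof (cases "even m")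
      case True
      then have "even d" using md odd by (metis even_mult_iff)
      then have "even n" using dn by (rule dvd_trans)
      then show ?thesis unfolding clips using True odd by (simp add: insert_commute)
    next
      case False
      then show ?thesis unfolding clips using odd by (simp add: insert_commute)
    qed
  qed
qed

end
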